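(* Let $H$ be an abelian group with trivial multiplicative Lie algebra structure, let $K$ be a multiplicative Lie algebra, and let $\sigma : K\to \mathrm{Aut}(H)$ be a group homomorphism to the group of automorphisms of $H$. Then there is a bijective correspondence between the set $LExt_\sigma(H,K)$ of equivalence classes of Lie center extensions of $H$ by $K$ with the given $\sigma$, and the second Lie center cohomology $H^2_{ML(\sigma)}(K,H)$.
   Context: A multiplicative Lie algebra is a group $(G,\cdot)$ with a binary operation $*$ such that for all $x,y,z\in G$, writing ${}^{x}y = xyx^{-1}$: (1) $x*x=1$; (2) $x*(yz) = (x*y)\,{}^{y}(x*z)$; (3) $(xy)*z = {}^{x}(y*z)\,(x*z)$; (4) $((x*y)*{}^{y}z)\,((y*z)*{}^{z}x)\,((z*x)*{}^{x}y)=1$; (5) ${}^{z}(x*y) = ({}^{z}x)*({}^{z}y)$. Homomorphisms preserve both operations. The structure is trivial if $x*y=1$ for all $x,y$. An ideal is a normal subgroup $I$ with $g*i\in I$ for all $g\in G$, $i\in I$. An extension of $H$ by $K$ is a short exact sequence $E: 1\to H\to G\xrightarrow{\beta} K\to 1$ of multiplicative Lie algebras; $H$ is regarded as an ideal of $G$. It is a Lie center extension if $H\subseteq LZ(G)=\{x\in G: x*y=1\ \forall y\in G\}$. Two extensions of $H$ by $K$ with middle terms $G_1,G_2$ are equivalent if there is a multiplicative Lie algebra isomorphism $G_1\to G_2$ inducing the identity on $H$ and on $K$. A section of $E$ is a map $t:K\to G$ with $\beta\circ t=\mathrm{id}_K$ and $t(1)=1$. For a Lie center extension $E$, $\sigma_E:K\to\mathrm{Aut}(H)$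 is the group homomorphism $\sigma_E(x)(a)=t(x)\,a\,t(x)^{-1}$, which does not depend on the section $t$ nor on the representative of the equivalence class. $LExt_\sigma(H,K)$ is the set of equivalence classes of Lie center extensions $E$ of $H$ by $K$ with $\sigma_E=\sigma$. Write $\sigma_x=\sigma(x)$. A multiplicative Lie center 2-cocycle of $K$ with coefficients in $H$ (with given $\sigma$) is a triplet $(f,h,\sigma)$ where $f,h:K\times K\to H$ are maps satisfying for all $x,y,z\in K$ and all $a,b,c\in H$: (L1) $f(1,x)=f(x,1)=1$ and $f(x,y)f(xy,z)=\sigma_x(f(y,z))f(x,yz)$; (L2) $h(x,1)=h(1,x)=h(x,x)=1$; (L3) $\sigma_{x*y}\Big(a^{-1}\sigma_y\big(ac\,\sigma_{x*z}(a^{-1}c^{-1})h(x,z)\big)f(y,x*z)\,\sigma_{y(x*z)}\big(f(y^{-1},y)^{-1}\sigma_{y^{-1}}(b^{-1})\big)f(y(x*z),y^{-1})\Big)f(x*y,{}^{y}(x*z))\,h(x,y)=\sigma_y(c)f(y,z)\,\sigma_{x*(yz)}\big(a^{-1}b^{-1}\sigma_y(c^{-1})f(y,z)^{-1}\big)h(x,yz)$; (L4) $c\,f(x,y)\,\sigma_{(xy)*z}\big(a^{-1}c^{-1}\sigma_x(b^{-1})f(x,y)^{-1}\big)h(xy,z)=\sigma_x\big(c\,\sigma_{y*z}(b^{-1}c^{-1})h(y,z)\big)f(x,y*z)\,\sigma_{x(y*z)}(f(x^{-1},x)^{-1})f(x(y*z),x^{-1})\,\sigma_{{}^{x}(y*z)}\big(c\,\sigma_{x*z}(a^{-1}c^{-1})h(x,z)\big)f({}^{x}(y*z),x*z)$;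 (L5) $\sigma_z\big(\sigma_{x*y}(a^{-1}b^{-1})h(x,y)\big)f(z,x*y)\,\sigma_{z(x*y)}\big(f(z^{-1},z)^{-1}\sigma_{z^{-1}}(c^{-1})\big)f(z(x*y),z^{-1})=c\,f(z,x)f(z,y)\,\sigma_{zx}(f(z^{-1},z)^{-1})\,\sigma_{zy}(f(z^{-1},z)^{-1})\,\sigma_{{}^{z}x}(c^{-1})\,\sigma_{{}^{z}y}(c^{-1})f(zy,z^{-1})f(zx,z^{-1})\,\sigma_{{}^{z}x*{}^{z}y}\big(c^{-2}\sigma_z(a^{-1}b^{-1})f(z,x)^{-1}f(z,y)^{-1}\sigma_{zx}(f(z^{-1},z))\sigma_{zy}(f(z^{-1},z))f(zy,z^{-1})^{-1}f(zx,z^{-1})^{-1}\sigma_{{}^{z}y}(c)\sigma_{{}^{z}x}(c)\big)h({}^{z}x,{}^{z}y)$; (L6) with $u=(x*y)*{}^{y}z$, $v=(y*z)*{}^{z}x$, $w=(z*x)*{}^{x}y$ and $A=ab^2\sigma_{x*y}(a^{-1}b^{-1})h(x,y)\sigma_y(c)f(y,z)\sigma_{yz}(f(y^{-1},y)^{-1})f(yz,y^{-1})\sigma_{{}^{y}z}(b^{-1})$, $B=bc^2\sigma_{y*z}(b^{-1}c^{-1})h(y,z)\sigma_z(a)f(z,x)\sigma_{zx}(f(z^{-1},z)^{-1})f(zx,z^{-1})\sigma_{{}^{z}x}(c^{-1})$, $C=ca^2\sigma_{z*x}(c^{-1}a^{-1})h(z,x)\sigma_x(b)f(x,y)\sigma_{xy}(f(x^{-1},x)^{-1})f(xy,x^{-1})\sigma_{{}^{x}y}(a^{-1})$,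 one has $A\,\sigma_u(A^{-1})\,h(x*y,{}^{y}z)\;\sigma_u\big(B\,\sigma_v(B^{-1})\,h(y*z,{}^{z}x)\big)\,f(u,v)\;\sigma_{uv}\big(C\,\sigma_w(C^{-1})\,h(z*x,{}^{x}y)\big)\,f(uv,w)=1$. $Z^2_{ML(\sigma)}(K,H)$ is the set of all such cocycles, with operation $(f,h,\sigma)\cdot(f',h',\sigma)=(ff',hh',\sigma)$. For a map $g:K\to H$ with $g(1)=1$ put $\delta g(x,y)=g(x)g(xy)^{-1}\sigma_x(g(y))$ and $g^*(x,y)=g(x*y)^{-1}g(x)g(y)\sigma_{x*y}(g(x)^{-1}g(y)^{-1})$; $B^2_{ML(\sigma)}(K,H)$ is the set of all triplets $(\delta g,g^*,\sigma)$. $H^2_{ML(\sigma)}(K,H)$ is the quotient $Z^2_{ML(\sigma)}(K,H)/B^2_{ML(\sigma)}(K,H)$, i.e. the set of classes of $Z^2_{ML(\sigma)}(K,H)$ for the relation: $(f,h,\sigma)$ and $(f',h',\sigma)$ are equivalent iff $f'=\delta g\cdot f$ and $h'=g^*\cdot h$ for some map $g:K\to H$ with $g(1)=1$. *)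

theory Defs
  imports "HOL-Algebra.Coset" "HOL-Algebra.Bij"
begin

section \<open>Multiplicative Lie algebras\<close>

record 'a mlie = "'a monoid" +
  lie :: "'a \<Rightarrow> 'a \<Rightarrow> 'a" (infixl "\<star>\<index>" 70)

definition conj_by :: "('a, 'm) monoid_scheme \<Rightarrow> 'a \<Rightarrow> 'a \<Rightarrow> 'a" (infixr "\<rhd>\<index>" 75)
  where "x \<rhd>\<^bsub>G\<^esub> y = x \<otimes>\<^bsub>G\<^esub> y \<otimes>\<^bsub>G\<^esub> inv\<^bsub>G\<^esub> x"

locale mult_lie_algebra = group G for G :: "('a, 'm) mlie_scheme" (structure) +
  assumes lie_closed:
      "\<lbrakk>x \<in> carrier G; y \<in> carrier G\<rbrakk> \<Longrightarrow> x \<star> y \<in> carrier G"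
    and lie_self:
      "x \<in> carrier G \<Longrightarrow> x \<star> x = \<one>"
    and lie_mult_right:
      "\<lbrakk>x \<in> carrier G; y \<in> carrier G; z \<in> carrier G\<rbrakk>
        \<Longrightarrow> x \<star> (y \<otimes> z) = (x \<star> y) \<otimes> (y \<rhd> (x \<star> z))"
    and lie_mult_left:
      "\<lbrakk>x \<in> carrier G; y \<in> carrier G; z \<in> carrier G\<rbrakk>
        \<Longrightarrow> (x \<otimes> y) \<star> z = (x \<rhd> (y \<star> z)) \<otimes> (x \<star> z)"
    and lie_jacobi:
      "\<lbrakk>x \<in> carrier G; y \<in> carrier G; z \<in> carrier G\<rbrakk>
        \<Longrightarrow> ((x \<star> y) \<star> (y \<rhd> z)) \<otimes> ((y \<star> z) \<star> (z \<rhd> x)) \<otimes> ((z \<star> x) \<star> (x \<rhd> y)) = \<one>"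
    and lie_conj:
      "\<lbrakk>x \<in> carrier G; y \<in> carrier G; z \<in> carrier G\<rbrakk>
        \<Longrightarrow> z \<rhd> (x \<star> y) = (z \<rhd> x) \<star> (z \<rhd> y)"

definition trivial_lie :: "('a, 'm) mlie_scheme \<Rightarrow> bool"
  where "trivial_lie G \<longleftrightarrow> (\<forall>x\<in>carrier G. \<forall>y\<in>carrier G. x \<star>\<^bsub>G\<^esub> y = \<one>\<^bsub>G\<^esub>)"

definition mlie_hom :: "('a, 'm) mlie_scheme \<Rightarrow> ('b, 'n) mlie_scheme \<Rightarrow> ('a \<Rightarrow> 'b) set"
  where "mlie_hom G G' = {\<phi> \<in> hom G G'.
    \<forall>x\<in>carrier G. \<forall>y\<in>carrier G. \<phi> (x \<star>\<^bsub>G\<^esub> y) = \<phi> x \<star>\<^bsub>G'\<^esub> \<phi> y}"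

definition mlie_iso :: "('a, 'm) mlie_scheme \<Rightarrow> ('b, 'n) mlie_scheme \<Rightarrow> ('a \<Rightarrow> 'b) set"
  where "mlie_iso G G' = {\<phi> \<in> mlie_hom G G'. bij_betw \<phi> (carrier G) (carrier G')}"

definition lie_center :: "('a, 'm) mlie_scheme \<Rightarrow> 'a set"
  where "lie_center G = {x \<in> carrier G. \<forall>y\<in>carrier G. x \<star>\<^bsub>G\<^esub> y = \<one>\<^bsub>G\<^esub>}"


section \<open>Lie center extensions\<close>

text \<open>
  An extension of \<open>H\<close> by \<open>K\<close> is recorded by its middle term together with the two maps.
  The inclusion of \<open>H\<close> is an injective homomorphism \<open>incl\<close>, and \<open>H\<close> is identified with the ideal
  \<open>incl E ` carrier H\<close>; that this is an ideal follows from exactness.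
\<close>

record ('h, 'g, 'k) extension =
  mid :: "'g mlie"
  incl :: "'h \<Rightarrow> 'g"
  proj :: "'g \<Rightarrow> 'k"

definition is_extension :: "'h mlie \<Rightarrow> 'k mlie \<Rightarrow> ('h, 'g, 'k) extension \<Rightarrow> bool"
  where "is_extension H K E \<longleftrightarrow>
    mult_lie_algebra (mid E) \<and>
    incl E \<in> mlie_hom H (mid E) \<and>
    proj E \<in> mlie_hom (mid E) K \<and>
    inj_on (incl E) (carrier H) \<and>
    incl E ` carrier H = kernel (mid E) K (proj E) \<and>
    proj E ` carrier (mid E) = carrier K"

definition is_lie_center_extension :: "'h mlie \<Rightarrow> 'k mlie \<Rightarrow> ('h, 'g, 'k) extension \<Rightarrow> bool"
  where "is_lie_center_extension H K E \<longleftrightarrow>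
    is_extension H K E \<and> incl E ` carrier H \<subseteq> lie_center (mid E)"

definition ext_equiv ::
    "'h mlie \<Rightarrow> 'k mlie \<Rightarrow> ('h, 'g1, 'k) extension \<Rightarrow> ('h, 'g2, 'k) extension \<Rightarrow> bool"
  where "ext_equiv H K E E' \<longleftrightarrow> (\<exists>\<phi> \<in> mlie_iso (mid E) (mid E').
    (\<forall>a\<in>carrier H. \<phi> (incl E a) = incl E' a) \<and>
    (\<forall>x\<in>carrier (mid E). proj E' (\<phi> x) = proj E x))"

definition is_section :: "'k mlie \<Rightarrow> ('h, 'g, 'k) extension \<Rightarrow> ('k \<Rightarrow> 'g) \<Rightarrow> bool"
  where "is_section K E t \<longleftrightarrow>
    t \<in> carrier K \<rightarrow> carrier (mid E) \<and>
    (\<forall>x\<in>carrier K. proj E (t x) = x) \<and>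
    t \<one>\<^bsub>K\<^esub> = \<one>\<^bsub>mid E\<^esub>"

text \<open>
  The action \<open>a \<mapsto> t(x) a t(x)\<inverse>\<close> on \<open>H\<close>, pulled back along \<open>incl\<close> and extensional on
  \<open>carrier H\<close>, as are the elements of \<^const>\<open>auto\<close>.
\<close>

definition section_action ::
    "'h mlie \<Rightarrow> ('h, 'g, 'k) extension \<Rightarrow> ('k \<Rightarrow> 'g) \<Rightarrow> 'k \<Rightarrow> 'h \<Rightarrow> 'h"
  where "section_action H E t x =
    (\<lambda>a\<in>carrier H. inv_into (carrier H) (incl E) (t x \<rhd>\<^bsub>mid E\<^esub> incl E a))"

text \<open>
  \<open>\<sigma>\<^sub>E = \<sigma>\<close>. The action does not depend on the section; every extension has a section, so the
  quantification over all sections is not vacuous.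
\<close>

definition induces_action ::
    "'h mlie \<Rightarrow> 'k mlie \<Rightarrow> ('h, 'g, 'k) extension \<Rightarrow> ('k \<Rightarrow> 'h \<Rightarrow> 'h) \<Rightarrow> bool"
  where "induces_action H K E \<sigma> \<longleftrightarrow>
    (\<forall>t. is_section K E t \<longrightarrow> (\<forall>x\<in>carrier K. section_action H E t x = \<sigma> x))"

definition lie_center_extensions ::
    "'h mlie \<Rightarrow> 'k mlie \<Rightarrow> ('k \<Rightarrow> 'h \<Rightarrow> 'h) \<Rightarrow> ('h, 'g, 'k) extension set"
  where "lie_center_extensions H K \<sigma> =
    {E. is_lie_center_extension H K E \<and> induces_action H K E \<sigma>}"

text \<open>
  The middle terms range over the algebras whose elements have type \<open>'g\<close>. Since the carrier of a
  middle term is equipotent to \<open>carrier H \<times> carrier K\<close>, every extension is equivalent to one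
  over \<open>'g\<close> as soon as \<open>carrier H \<times> carrier K\<close> embeds into \<open>'g\<close>.
\<close>

definition LExt ::
    "'h mlie \<Rightarrow> 'k mlie \<Rightarrow> ('k \<Rightarrow> 'h \<Rightarrow> 'h) \<Rightarrow> ('h, 'g, 'k) extension set set"
  where "LExt H K \<sigma> = lie_center_extensions H K \<sigma> //
    {(E, E'). E \<in> lie_center_extensions H K \<sigma> \<and> E' \<in> lie_center_extensions H K \<sigma> \<and>
      ext_equiv H K E E'}"


section \<open>Second Lie center cohomology\<close>

text \<open>
  In the cocycle conditions the operations of \<open>K\<close> are written \<open>\<otimes>, inv, \<star>, \<rhd>, \<one>\<close>, and those
  of \<open>H\<close> are written \<open>\<cdot>\<close> and \<open>\<^sup>-\<close>.
\<close>

context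
  fixes K :: "'k mlie" (structure) and H :: "'h mlie" and \<sigma> :: "'k \<Rightarrow> 'h \<Rightarrow> 'h"
begin

abbreviation H_mult :: "'h \<Rightarrow> 'h \<Rightarrow> 'h" (infixl "\<cdot>" 70)
  where "a \<cdot> b \<equiv> a \<otimes>\<^bsub>H\<^esub> b"

abbreviation H_inv :: "'h \<Rightarrow> 'h" ("_\<^sup>-" [1000] 999)
  where "a\<^sup>- \<equiv> inv\<^bsub>H\<^esub> a"

definition cocycle_L1 :: "('k \<times> 'k \<Rightarrow> 'h) \<Rightarrow> 'k \<Rightarrow> 'k \<Rightarrow> 'k \<Rightarrow> bool"
  where "cocycle_L1 f x y z \<longleftrightarrow>
    f (\<one>, x) = \<one>\<^bsub>H\<^esub> \<and> f (x, \<one>) = \<one>\<^bsub>H\<^esub> \<and>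
    f (x, y) \<cdot> f (x \<otimes> y, z) = \<sigma> x (f (y, z)) \<cdot> f (x, y \<otimes> z)"

definition cocycle_L2 :: "('k \<times> 'k \<Rightarrow> 'h) \<Rightarrow> 'k \<Rightarrow> bool"
  where "cocycle_L2 h x \<longleftrightarrow> h (x, \<one>) = \<one>\<^bsub>H\<^esub> \<and> h (\<one>, x) = \<one>\<^bsub>H\<^esub> \<and> h (x, x) = \<one>\<^bsub>H\<^esub>"

definition cocycle_L3 ::
    "('k \<times> 'k \<Rightarrow> 'h) \<Rightarrow> ('k \<times> 'k \<Rightarrow> 'h) \<Rightarrow> 'k \<Rightarrow> 'k \<Rightarrow> 'k \<Rightarrow> 'h \<Rightarrow> 'h \<Rightarrow> 'h \<Rightarrow> bool"
  where "cocycle_L3 f h x y z a b c \<longleftrightarrow>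
    \<sigma> (x \<star> y) (a\<^sup>- \<cdot> \<sigma> y (a \<cdot> c \<cdot> \<sigma> (x \<star> z) (a\<^sup>- \<cdot> c\<^sup>-) \<cdot> h (x, z)) \<cdot> f (y, x \<star> z)
        \<cdot> \<sigma> (y \<otimes> (x \<star> z)) ((f (inv y, y))\<^sup>- \<cdot> \<sigma> (inv y) (b\<^sup>-))
        \<cdot> f (y \<otimes> (x \<star> z), inv y))
      \<cdot> f (x \<star> y, y \<rhd> (x \<star> z)) \<cdot> h (x, y)
    = \<sigma> y c \<cdot> f (y, z) \<cdot> \<sigma> (x \<star> (y \<otimes> z)) (a\<^sup>- \<cdot> b\<^sup>- \<cdot> \<sigma> y (c\<^sup>-) \<cdot> (f (y, z))\<^sup>-)
      \<cdot> h (x, y \<otimes> z)"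

definition cocycle_L4 ::
    "('k \<times> 'k \<Rightarrow> 'h) \<Rightarrow> ('k \<times> 'k \<Rightarrow> 'h) \<Rightarrow> 'k \<Rightarrow> 'k \<Rightarrow> 'k \<Rightarrow> 'h \<Rightarrow> 'h \<Rightarrow> 'h \<Rightarrow> bool"
  where "cocycle_L4 f h x y z a b c \<longleftrightarrow>
    c \<cdot> f (x, y) \<cdot> \<sigma> ((x \<otimes> y) \<star> z) (a\<^sup>- \<cdot> c\<^sup>- \<cdot> \<sigma> x (b\<^sup>-) \<cdot> (f (x, y))\<^sup>-)
      \<cdot> h (x \<otimes> y, z)
    = \<sigma> x (c \<cdot> \<sigma> (y \<star> z) (b\<^sup>- \<cdot> c\<^sup>-) \<cdot> h (y, z)) \<cdot> f (x, y \<star> z)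
      \<cdot> \<sigma> (x \<otimes> (y \<star> z)) ((f (inv x, x))\<^sup>-) \<cdot> f (x \<otimes> (y \<star> z), inv x)
      \<cdot> \<sigma> (x \<rhd> (y \<star> z)) (c \<cdot> \<sigma> (x \<star> z) (a\<^sup>- \<cdot> c\<^sup>-) \<cdot> h (x, z))
      \<cdot> f (x \<rhd> (y \<star> z), x \<star> z)"

definition cocycle_L5 ::
    "('k \<times> 'k \<Rightarrow> 'h) \<Rightarrow> ('k \<times> 'k \<Rightarrow> 'h) \<Rightarrow> 'k \<Rightarrow> 'k \<Rightarrow> 'k \<Rightarrow> 'h \<Rightarrow> 'h \<Rightarrow> 'h \<Rightarrow> bool"
  where "cocycle_L5 f h x y z a b c \<longleftrightarrow>
    \<sigma> z (\<sigma> (x \<star> y) (a\<^sup>- \<cdot> b\<^sup>-) \<cdot> h (x, y)) \<cdot> f (z, x \<star> y)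
      \<cdot> \<sigma> (z \<otimes> (x \<star> y)) ((f (inv z, z))\<^sup>- \<cdot> \<sigma> (inv z) (c\<^sup>-))
      \<cdot> f (z \<otimes> (x \<star> y), inv z)
    = c \<cdot> f (z, x) \<cdot> f (z, y)
      \<cdot> \<sigma> (z \<otimes> x) ((f (inv z, z))\<^sup>-) \<cdot> \<sigma> (z \<otimes> y) ((f (inv z, z))\<^sup>-)
      \<cdot> \<sigma> (z \<rhd> x) (c\<^sup>-) \<cdot> \<sigma> (z \<rhd> y) (c\<^sup>-)
      \<cdot> f (z \<otimes> y, inv z) \<cdot> f (z \<otimes> x, inv z)
      \<cdot> \<sigma> ((z \<rhd> x) \<star> (z \<rhd> y))
          (c\<^sup>- \<cdot> c\<^sup>- \<cdot> \<sigma> z (a\<^sup>- \<cdot> b\<^sup>-) \<cdot> (f (z, x))\<^sup>- \<cdot> (f (z, y))\<^sup>-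
            \<cdot> \<sigma> (z \<otimes> x) (f (inv z, z)) \<cdot> \<sigma> (z \<otimes> y) (f (inv z, z))
            \<cdot> (f (z \<otimes> y, inv z))\<^sup>- \<cdot> (f (z \<otimes> x, inv z))\<^sup>-
            \<cdot> \<sigma> (z \<rhd> y) c \<cdot> \<sigma> (z \<rhd> x) c)
      \<cdot> h (z \<rhd> x, z \<rhd> y)"

definition cocycle_L6 ::
    "('k \<times> 'k \<Rightarrow> 'h) \<Rightarrow> ('k \<times> 'k \<Rightarrow> 'h) \<Rightarrow> 'k \<Rightarrow> 'k \<Rightarrow> 'k \<Rightarrow> 'h \<Rightarrow> 'h \<Rightarrow> 'h \<Rightarrow> bool"
  where "cocycle_L6 f h x y z a b c \<longleftrightarrow>
    (let u = (x \<star> y) \<star> (y \<rhd> z);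
         v = (y \<star> z) \<star> (z \<rhd> x);
         w = (z \<star> x) \<star> (x \<rhd> y);
         A = a \<cdot> b \<cdot> b \<cdot> \<sigma> (x \<star> y) (a\<^sup>- \<cdot> b\<^sup>-) \<cdot> h (x, y) \<cdot> \<sigma> y c \<cdot> f (y, z)
           \<cdot> \<sigma> (y \<otimes> z) ((f (inv y, y))\<^sup>-) \<cdot> f (y \<otimes> z, inv y) \<cdot> \<sigma> (y \<rhd> z) (b\<^sup>-);
         B = b \<cdot> c \<cdot> c \<cdot> \<sigma> (y \<star> z) (b\<^sup>- \<cdot> c\<^sup>-) \<cdot> h (y, z) \<cdot> \<sigma> z a \<cdot> f (z, x)
           \<cdot> \<sigma> (z \<otimes> x) ((f (inv z, z))\<^sup>-) \<cdot> f (z \<otimes> x, inv z) \<cdot> \<sigma> (z \<rhd> x) (c\<^sup>-);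
         C = c \<cdot> a \<cdot> a \<cdot> \<sigma> (z \<star> x) (c\<^sup>- \<cdot> a\<^sup>-) \<cdot> h (z, x) \<cdot> \<sigma> x b \<cdot> f (x, y)
           \<cdot> \<sigma> (x \<otimes> y) ((f (inv x, x))\<^sup>-) \<cdot> f (x \<otimes> y, inv x) \<cdot> \<sigma> (x \<rhd> y) (a\<^sup>-)
     in A \<cdot> \<sigma> u (A\<^sup>-) \<cdot> h (x \<star> y, y \<rhd> z)
        \<cdot> \<sigma> u (B \<cdot> \<sigma> v (B\<^sup>-) \<cdot> h (y \<star> z, z \<rhd> x)) \<cdot> f (u, v)
        \<cdot> \<sigma> (u \<otimes> v) (C \<cdot> \<sigma> w (C\<^sup>-) \<cdot> h (z \<star> x, x \<rhd> y)) \<cdot> f (u \<otimes> v, w)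
        = \<one>\<^bsub>H\<^esub>)"

definition coboundary_mult :: "('k \<Rightarrow> 'h) \<Rightarrow> 'k \<times> 'k \<Rightarrow> 'h" \<comment> \<open>\<open>\<delta>g\<close>\<close>
  where "coboundary_mult g =
    (\<lambda>(x, y) \<in> carrier K \<times> carrier K. g x \<cdot> (g (x \<otimes> y))\<^sup>- \<cdot> \<sigma> x (g y))"

definition coboundary_lie :: "('k \<Rightarrow> 'h) \<Rightarrow> 'k \<times> 'k \<Rightarrow> 'h" \<comment> \<open>\<open>g\<^sup>*\<close>\<close>
  where "coboundary_lie g =
    (\<lambda>(x, y) \<in> carrier K \<times> carrier K.
      (g (x \<star> y))\<^sup>- \<cdot> g x \<cdot> g y \<cdot> \<sigma> (x \<star> y) ((g x)\<^sup>- \<cdot> (g y)\<^sup>-))"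

end

type_synonym ('k, 'h) cochain = "('k \<times> 'k \<Rightarrow> 'h) \<times> ('k \<times> 'k \<Rightarrow> 'h) \<times> ('k \<Rightarrow> 'h \<Rightarrow> 'h)"

text \<open>
  Maps \<open>K \<times> K \<rightarrow> H\<close> are taken extensional on \<open>carrier K \<times> carrier K\<close>, so that they are equal
  as HOL functions exactly when they agree there.
\<close>

definition Z2_ML :: "'k mlie \<Rightarrow> 'h mlie \<Rightarrow> ('k \<Rightarrow> 'h \<Rightarrow> 'h) \<Rightarrow> ('k, 'h) cochain set"
  where "Z2_ML K H \<sigma> = {(f, h, \<sigma>) | f h.
    f \<in> carrier K \<times> carrier K \<rightarrow>\<^sub>E carrier H \<and>
    h \<in> carrier K \<times> carrier K \<rightarrow>\<^sub>E carrier H \<and>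
    (\<forall>x\<in>carrier K. \<forall>y\<in>carrier K. \<forall>z\<in>carrier K.
      cocycle_L1 K H \<sigma> f x y z \<and> cocycle_L2 K H h x \<and>
      (\<forall>a\<in>carrier H. \<forall>b\<in>carrier H. \<forall>c\<in>carrier H.
        cocycle_L3 K H \<sigma> f h x y z a b c \<and>
        cocycle_L4 K H \<sigma> f h x y z a b c \<and>
        cocycle_L5 K H \<sigma> f h x y z a b c \<and>
        cocycle_L6 K H \<sigma> f h x y z a b c))}"

fun cochain_mult ::
    "'k mlie \<Rightarrow> 'h mlie \<Rightarrow> ('k, 'h) cochain \<Rightarrow> ('k, 'h) cochain \<Rightarrow> ('k, 'h) cochain"
  where "cochain_mult K H (f, h, \<sigma>) (f', h', _) =
    ((\<lambda>p \<in> carrier K \<times> carrier K. f p \<otimes>\<^bsub>H\<^esub> f' p),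
     (\<lambda>p \<in> carrier K \<times> carrier K. h p \<otimes>\<^bsub>H\<^esub> h' p), \<sigma>)"

definition B2_ML :: "'k mlie \<Rightarrow> 'h mlie \<Rightarrow> ('k \<Rightarrow> 'h \<Rightarrow> 'h) \<Rightarrow> ('k, 'h) cochain set"
  where "B2_ML K H \<sigma> = {(coboundary_mult K H \<sigma> g, coboundary_lie K H \<sigma> g, \<sigma>) | g.
    g \<in> carrier K \<rightarrow> carrier H \<and> g \<one>\<^bsub>K\<^esub> = \<one>\<^bsub>H\<^esub>}"

text \<open>
  \<open>Z\<^sup>2\<close> may be empty, in which case it is not a group and does not contain \<open>B\<^sup>2\<close>; the quotient is
  therefore formed as a set of classes.
\<close>

definition H2_ML :: "'k mlie \<Rightarrow> 'h mlie \<Rightarrow> ('k \<Rightarrow> 'h \<Rightarrow> 'h) \<Rightarrow> ('k, 'h) cochain set set"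
  where "H2_ML K H \<sigma> = Z2_ML K H \<sigma> //
    {(c, c'). c \<in> Z2_ML K H \<sigma> \<and> c' \<in> Z2_ML K H \<sigma> \<and>
      (\<exists>b\<in>B2_ML K H \<sigma>. c' = cochain_mult K H b c)}"

end

theory Submission
  imports Defs
begin

text \<open>
  A pair of normalized cochains \<open>(f, h)\<close> turns \<open>H \<times> K\<close> into a structure with
  \<open>(a, x) (b, y) = (a \<sigma>\<^sub>x(b) f(x, y), x y)\<close> and
  \<open>(a, x) * (b, y) = (a b \<sigma>\<^sub>x\<^sub>*\<^sub>y(a\<inverse> b\<inverse>) h(x, y), x * y)\<close>. Evaluated on
  \<open>(a, x), (b, y), (c, z)\<close>, each axiom of a multiplicative Lie algebra becomes, after cancelling a
  common factor in \<open>H\<close>, exactly one of the cocycle conditions; so cocycles are the same as algebra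
  structures of this shape. A section \<open>t\<close> of a Lie center extension identifies its middle term with
  such a structure through \<open>(a, x) \<mapsto> a t(x)\<close>. An equivalence between two of them has the form
  \<open>(a, x) \<mapsto> (a g(x), x)\<close>, and it preserves the operations iff the cocycles differ by the
  coboundary of \<open>g\<close>. So \<open>c \<mapsto> H \<times>\<^sub>c K\<close> reflects and preserves equivalence and meets every class.
\<close>

text \<open>On \<open>B\<close> the relation \<open>S\<close> is the pullback of \<open>R\<close>
  along \<open>F\<close>, so \<open>F\<close> descends to an injection of quotients; every class of
  \<open>R\<close> meets the image of \<open>F\<close>, so the injection is onto. That
  \<open>S\<close> is an equivalence relation is inherited from \<open>R\<close>, which avoids a
  direct computation with coboundaries.\<close>

lemma quotient_bij_of_pullback:
  assumes R: "equiv A R"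
    and F: "\<And>c. c \<in> B \<Longrightarrow> F c \<in> A"
    and S: "S \<subseteq> B \<times> B"
      "\<And>c c'. c \<in> B \<Longrightarrow> c' \<in> B \<Longrightarrow> (c, c') \<in> S \<longleftrightarrow> (F c, F c') \<in> R"
    and surj: "\<And>E. E \<in> A \<Longrightarrow> \<exists>c\<in>B. (F c, E) \<in> R"
  shows "\<exists>\<Phi>. bij_betw \<Phi> (A // R) (B // S)"
proof -
  have eqS: "equiv B S"
  proof (rule equivI)
    show "S \<subseteq> B \<times> B" by fact
    show "refl_on B S"
      using S F R by (auto simp: refl_on_def equiv_def)
    show "sym S"
    proof (rule symI)
      fix c d assume cd: "(c, d) \<in> S"
      then have "c \<in> B" "d \<in> B" using S(1) by auto
      then show "(d, c) \<in> S" using cd S(2) R symD[of R] by (simp add: equiv_def)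
    qed
    show "trans S"
    proof (rule transI)
      fix c d e assume cde: "(c, d) \<in> S" "(d, e) \<in> S"
      then have "c \<in> B" "d \<in> B" "e \<in> B" using S(1) by auto
      then show "(c, e) \<in> S" using cde S(2) R transD[of R "F c" "F d" "F e"] by (simp add: equiv_def)
    qed
  qed
  \<comment> \<open>Saturating the image under \<open>R\<close> gives a map on classes without a
    choice of representatives.\<close>
  define \<Psi> where "\<Psi> X = R `` (F ` X)" for X
  have \<Psi>: "\<Psi> (S `` {c}) = R `` {F c}" if "c \<in> B" for c
  proof -
    have "F ` (S `` {c}) \<subseteq> R `` {F c}"
      using S that by auto
    moreover have "F c \<in> F ` (S `` {c})"
      using eqS that by (auto simp: equiv_def refl_on_def)
    ultimately show ?thesis
      unfolding \<Psi>_def using equivE[OF R] by (auto dest: transD)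
  qed
  have "bij_betw \<Psi> (B // S) (A // R)"
    unfolding bij_betw_def
  proof
    show "inj_on \<Psi> (B // S)"
    proof (rule inj_onI)
      fix X Y assume "X \<in> B // S" "Y \<in> B // S" and eq: "\<Psi> X = \<Psi> Y"
      then obtain c d where cd: "c \<in> B" "d \<in> B" "X = S `` {c}" "Y = S `` {d}"
        by (meson quotientE)
      then have "(F c, F d) \<in> R"
        using eq \<Psi> F eq_equiv_class[OF _ R] by simp
      then show "X = Y"
        using cd S equiv_class_eq[OF eqS] by simp
    qed
    show "\<Psi> ` (B // S) = A // R"
    proof
      show "\<Psi> ` (B // S) \<subseteq> A // R"
        using \<Psi> F by (auto elim!: quotientE simp: quotientI)
      show "A // R \<subseteq> \<Psi> ` (B // S)"
      proof
        fix Y assume "Y \<in> A // R"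
        then obtain E where E: "E \<in> A" "Y = R `` {E}" by (meson quotientE)
        then obtain c where c: "c \<in> B" "(F c, E) \<in> R" using surj by blast
        then have "Y = \<Psi> (S `` {c})"
          using E \<Psi> equiv_class_eq[OF R] by simp
        then show "Y \<in> \<Psi> ` (B // S)" using c quotientI by fast
      qed
    qed
  qed
  then show ?thesis using bij_betw_inv by blast
qed

section \<open>Multiplicative Lie algebras and equivalence of extensions\<close>

context mult_lie_algebra
begin

text \<open>The product axiom at \<open>\<one> \<otimes> \<one>\<close> makes
  \<open>x \<star> \<one>\<close> its own square, and the identity is the only idempotent of a
  group.\<close>

lemma lie_one_right [simp]: "x \<in> carrier G \<Longrightarrow> x \<star> \<one> = \<one>"
proof -
  assume x: "x \<in> carrier G"
  have "x \<star> (\<one> \<otimes> \<one>) = (x \<star> \<one>) \<otimes> (\<one> \<rhd> (x \<star> \<one>))"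
    using x by (intro lie_mult_right) auto
  then show ?thesis using x lie_closed[OF x one_closed]
    by (simp add: conj_by_def)
qed

lemma lie_one_left [simp]: "x \<in> carrier G \<Longrightarrow> \<one> \<star> x = \<one>"
proof -
  assume x: "x \<in> carrier G"
  have "(\<one> \<otimes> \<one>) \<star> x = (\<one> \<rhd> (\<one> \<star> x)) \<otimes> (\<one> \<star> x)"
    using x by (intro lie_mult_left) auto
  then show ?thesis using x lie_closed[OF one_closed x]
    by (simp add: conj_by_def)
qed

text \<open>Expanding \<open>(x \<otimes> y) \<star> (x \<otimes> y) = \<one>\<close> in the right
  argument and then in the left one leaves the conjugate by \<open>x\<close> of the product in
  question.\<close>

lemma lie_swap:
  assumes x: "x \<in> carrier G" and y: "y \<in> carrier G"
  shows "(y \<star> x) \<otimes> (x \<star> y) = \<one>"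
proof -
  note lie_closed[simp]
  have "\<one> = (x \<otimes> y) \<star> (x \<otimes> y)" using x y by (simp add: lie_self)
  also have "\<dots> = ((x \<otimes> y) \<star> x) \<otimes> (x \<rhd> ((x \<otimes> y) \<star> y))"
    using x y by (intro lie_mult_right) auto
  also have "\<dots> = (x \<rhd> (y \<star> x)) \<otimes> (x \<rhd> (x \<star> y))"
    using x y by (simp add: lie_mult_left lie_self conj_by_def)
  also have "\<dots> = x \<otimes> ((y \<star> x) \<otimes> (x \<star> y)) \<otimes> inv x"
    using x y by (simp add: conj_by_def m_assoc inv_solve_left')
  finally have "x \<otimes> ((y \<star> x) \<otimes> (x \<star> y)) = x"
    using x y by (simp add: inv_solve_right)
  then show ?thesis using x y by (simp add: r_cancel_one)
qed

text \<open>The definition of \<open>lie_center\<close> covers multiplication from one side only;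
  \<open>lie_swap\<close> gives the other.\<close>

lemma lie_center_lie_right:
  assumes "a \<in> lie_center G" "y \<in> carrier G" shows "y \<star> a = \<one>"
  using assms lie_swap[of a y] by (auto simp: lie_center_def lie_closed)

text \<open>Elements of the Lie center need not commute with \<open>x \<star> y\<close>, so the
  product axioms leave them behind as a conjugation. On section values this becomes the Lie
  operation of \<open>cocycle_algebra\<close>.\<close>

lemma lie_mult_lie_center:
  assumes a: "a \<in> lie_center G" and b: "b \<in> lie_center G"
    and x: "x \<in> carrier G" and y: "y \<in> carrier G"
  shows "(a \<otimes> x) \<star> (b \<otimes> y) = (a \<otimes> b) \<rhd> (x \<star> y)"
proof -
  note lie_closed[simp]
  have ab: "a \<in> carrier G" "b \<in> carrier G" using a b by (auto simp: lie_center_def)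
  have "(a \<otimes> x) \<star> (b \<otimes> y) = a \<rhd> (x \<star> (b \<otimes> y))"
    using a ab x y by (simp add: lie_mult_left lie_center_def conj_by_def)
  also have "x \<star> (b \<otimes> y) = b \<rhd> (x \<star> y)"
    using b ab x y by (simp add: lie_mult_right lie_center_lie_right conj_by_def)
  finally show ?thesis using ab x y by (simp add: conj_by_def m_assoc inv_mult_group)
qed

end

text \<open>Each identity holds in \<open>M\<close> because \<open>\<phi>\<close> is injective and
  sends its two sides to the two sides of an identity of \<open>G\<close>; surjectivity supplies the
  inverses. \<open>M\<close> is not presumed to be a group, so the lemma applies to raw
  records.\<close>

lemma mult_lie_algebra_pullback:
  assumes G: "mult_lie_algebra G"
    and bij: "bij_betw \<phi> (carrier M) (carrier G)"
    and closed: "\<one>\<^bsub>M\<^esub> \<in> carrier M"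
      "\<And>x y. x \<in> carrier M \<Longrightarrow> y \<in> carrier M \<Longrightarrow> x \<otimes>\<^bsub>M\<^esub> y \<in> carrier M"
      "\<And>x y. x \<in> carrier M \<Longrightarrow> y \<in> carrier M \<Longrightarrow> x \<star>\<^bsub>M\<^esub> y \<in> carrier M"
    and one: "\<phi> \<one>\<^bsub>M\<^esub> = \<one>\<^bsub>G\<^esub>"
    and mult: "\<And>x y. x \<in> carrier M \<Longrightarrow> y \<in> carrier M \<Longrightarrow> \<phi> (x \<otimes>\<^bsub>M\<^esub> y) = \<phi> x \<otimes>\<^bsub>G\<^esub> \<phi> y"
    and lie: "\<And>x y. x \<in> carrier M \<Longrightarrow> y \<in> carrier M \<Longrightarrow> \<phi> (x \<star>\<^bsub>M\<^esub> y) = \<phi> x \<star>\<^bsub>G\<^esub> \<phi> y"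
  shows "mult_lie_algebra M"
proof -
  interpret G: mult_lie_algebra G by fact
  have \<phi>c [simp]: "\<phi> x \<in> carrier G" if "x \<in> carrier M" for x
    using bij that by (auto simp: bij_betw_def)
  have eqI: "x = y" if "\<phi> x = \<phi> y" "x \<in> carrier M" "y \<in> carrier M" for x y
    using bij that by (auto simp: bij_betw_def inj_on_def)
  note [simp] = closed one mult lie G.lie_closed
  have group: "group M"
  proof (rule groupI)
    fix x assume x: "x \<in> carrier M"
    obtain y where y: "y \<in> carrier M" "\<phi> y = inv\<^bsub>G\<^esub> \<phi> x"
      using bij x G.inv_closed[OF \<phi>c[OF x]] unfolding bij_betw_def by (metis imageE)
    show "\<exists>y\<in>carrier M. y \<otimes>\<^bsub>M\<^esub> x = \<one>\<^bsub>M\<^esub>"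
      using x y by (intro bexI[of _ y] eqI) auto
  qed (auto intro!: eqI simp: G.m_assoc)
  interpret M: group M by fact
  have inv [simp]: "\<phi> (inv\<^bsub>M\<^esub> x) = inv\<^bsub>G\<^esub> \<phi> x" if "x \<in> carrier M" for x
    using that by (intro G.inv_equality[symmetric]) (simp_all flip: mult)
  have conj [simp]: "\<phi> (x \<rhd>\<^bsub>M\<^esub> y) = \<phi> x \<rhd>\<^bsub>G\<^esub> \<phi> y" "x \<rhd>\<^bsub>M\<^esub> y \<in> carrier M"
    if "x \<in> carrier M" "y \<in> carrier M" for x y
    using that by (auto simp: conj_by_def)
  show ?thesis
    by unfold_locales
      (auto intro!: eqI simp: G.lie_self G.lie_mult_right G.lie_mult_left G.lie_jacobi G.lie_conj)
qed

section \<open>Equivalence of extensions as an equivalence relation\<close>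

lemma ext_equiv_refl: "ext_equiv H K E E"
  unfolding ext_equiv_def mlie_iso_def mlie_hom_def
  by (rule bexI[of _ "\<lambda>x. x"]) (auto simp: hom_def bij_betw_def inj_on_def)

lemma ext_equiv_trans:
  assumes "ext_equiv H K E E'" "ext_equiv H K E' E''" shows "ext_equiv H K E E''"
proof -
  obtain \<phi> \<psi> where
    \<phi>: "\<phi> \<in> mlie_iso (mid E) (mid E')" "\<forall>a\<in>carrier H. \<phi> (incl E a) = incl E' a"
      "\<forall>x\<in>carrier (mid E). proj E' (\<phi> x) = proj E x" and
    \<psi>: "\<psi> \<in> mlie_iso (mid E') (mid E'')" "\<forall>a\<in>carrier H. \<psi> (incl E' a) = incl E'' a"
      "\<forall>x\<in>carrier (mid E'). proj E'' (\<psi> x) = proj E' x"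
    using assms unfolding ext_equiv_def by blast
  have c: "\<phi> x \<in> carrier (mid E')" if "x \<in> carrier (mid E)" for x
    using \<phi> that by (auto simp: mlie_iso_def bij_betw_def)
  have "\<psi> \<circ> \<phi> \<in> mlie_iso (mid E) (mid E'')"
    using \<phi>(1) \<psi>(1) c
    by (auto simp: mlie_iso_def mlie_hom_def hom_compose intro: bij_betw_trans)
  then show ?thesis
    unfolding ext_equiv_def using \<phi> \<psi> c by (intro bexI[of _ "\<psi> \<circ> \<phi>"]) auto
qed

text \<open>The inverse of \<open>\<phi>\<close> preserves the operations because the middle term of
  \<open>E\<close> is closed under them, which the hypothesis on \<open>E\<close> supplies.\<close>

lemma ext_equiv_sym:
  assumes E: "is_extension H K E" and eq: "ext_equiv H K E E'" shows "ext_equiv H K E' E"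
proof -
  interpret G: mult_lie_algebra "mid E" using E by (simp add: is_extension_def)
  obtain \<phi> where
    \<phi>: "\<phi> \<in> mlie_iso (mid E) (mid E')" "\<forall>a\<in>carrier H. \<phi> (incl E a) = incl E' a"
      "\<forall>x\<in>carrier (mid E). proj E' (\<phi> x) = proj E x"
    using eq unfolding ext_equiv_def by blast
  then have bij: "bij_betw \<phi> (carrier (mid E)) (carrier (mid E'))"
    and hom: "\<phi> \<in> hom (mid E) (mid E')"
    and lie: "\<And>x y. x \<in> carrier (mid E) \<Longrightarrow> y \<in> carrier (mid E) \<Longrightarrow>
      \<phi> (x \<star>\<^bsub>mid E\<^esub> y) = \<phi> x \<star>\<^bsub>mid E'\<^esub> \<phi> y"
    by (auto simp: mlie_iso_def mlie_hom_def)
  define \<psi> where "\<psi> = inv_into (carrier (mid E)) \<phi>"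
  have \<psi>: "\<psi> y \<in> carrier (mid E)" "\<phi> (\<psi> y) = y" if "y \<in> carrier (mid E')" for y
    using bij that by (auto simp: \<psi>_def bij_betw_def inv_into_into f_inv_into_f)
  have \<psi>\<phi>: "\<psi> (\<phi> x) = x" if "x \<in> carrier (mid E)" for x
    using bij that by (auto simp: \<psi>_def bij_betw_def)
  have "\<psi> \<in> mlie_iso (mid E') (mid E)"
    unfolding mlie_iso_def mlie_hom_def
  proof (safe intro!: homI)
    fix x y assume xy: "x \<in> carrier (mid E')" "y \<in> carrier (mid E')"
    show "\<psi> (x \<otimes>\<^bsub>mid E'\<^esub> y) = \<psi> x \<otimes>\<^bsub>mid E\<^esub> \<psi> y"
      using \<psi>\<phi>[of "\<psi> x \<otimes>\<^bsub>mid E\<^esub> \<psi> y"] \<psi> xy hom by (simp add: hom_mult)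
    show "\<psi> (x \<star>\<^bsub>mid E'\<^esub> y) = \<psi> x \<star>\<^bsub>mid E\<^esub> \<psi> y"
      using \<psi>\<phi>[of "\<psi> x \<star>\<^bsub>mid E\<^esub> \<psi> y"] \<psi> xy by (simp add: lie G.lie_closed)
  next
    show "bij_betw \<psi> (carrier (mid E')) (carrier (mid E))"
      unfolding \<psi>_def using bij by (rule bij_betw_inv_into)
  qed (simp add: \<psi>)
  moreover have "\<psi> (incl E' a) = incl E a" if "a \<in> carrier H" for a
  proof -
    have "incl E a \<in> carrier (mid E)"
      using E that by (auto simp: is_extension_def mlie_hom_def hom_def)
    then show ?thesis using \<psi>\<phi> \<phi>(2) that by force
  qed
  ultimately show ?thesis
    unfolding ext_equiv_def using \<phi>(3) \<psi> by (intro bexI[of _ \<psi>]) force+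
qed

section \<open>The algebra of a cocycle\<close>

locale center_action = K: mult_lie_algebra K + H: comm_group H
  for K :: "'k mlie" (structure) and H :: "'h mlie" +
  fixes \<sigma> :: "'k \<Rightarrow> 'h \<Rightarrow> 'h"
  assumes trivial: "trivial_lie H"
    and hom: "\<sigma> \<in> hom K (AutoGroup H)"
begin

abbreviation hmult (infixl "\<cdot>" 70) where "a \<cdot> b \<equiv> a \<otimes>\<^bsub>H\<^esub> b"
abbreviation hinv ("_\<^sup>-" [1000] 999) where "a\<^sup>- \<equiv> inv\<^bsub>H\<^esub> a"

lemma \<sigma>_auto: "x \<in> carrier K \<Longrightarrow> \<sigma> x \<in> auto H"
  using hom by (auto simp: hom_def AutoGroup_def)

text \<open>Members of \<open>AutoGroup H\<close> are extensional, so \<open>\<sigma> x\<close> can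
  be compared with \<open>section_action\<close> on \<open>carrier H\<close> alone.\<close>

lemma \<sigma>_extensional: "x \<in> carrier K \<Longrightarrow> \<sigma> x \<in> extensional (carrier H)"
  using \<sigma>_auto by (auto simp: auto_def Bij_def)

lemma \<sigma>_group_hom: "x \<in> carrier K \<Longrightarrow> group_hom H H (\<sigma> x)"
  using \<sigma>_auto by (auto simp: auto_def group_hom_def group_hom_axioms_def)

lemma \<sigma>_closed [simp]: "x \<in> carrier K \<Longrightarrow> a \<in> carrier H \<Longrightarrow> \<sigma> x a \<in> carrier H"
  by (rule group_hom.hom_closed[OF \<sigma>_group_hom])

lemma \<sigma>_H_one [simp]: "x \<in> carrier K \<Longrightarrow> \<sigma> x \<one>\<^bsub>H\<^esub> = \<one>\<^bsub>H\<^esub>"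
  by (rule group_hom.hom_one[OF \<sigma>_group_hom])

lemma \<sigma>_H_mult:
  "x \<in> carrier K \<Longrightarrow> a \<in> carrier H \<Longrightarrow> b \<in> carrier H \<Longrightarrow> \<sigma> x (a \<cdot> b) = \<sigma> x a \<cdot> \<sigma> x b"
  by (rule group_hom.hom_mult[OF \<sigma>_group_hom])

lemma \<sigma>_H_inv: "x \<in> carrier K \<Longrightarrow> a \<in> carrier H \<Longrightarrow> \<sigma> x (a\<^sup>-) = (\<sigma> x a)\<^sup>-"
  by (rule group_hom.hom_inv[OF \<sigma>_group_hom])

lemma \<sigma>_one [simp]: "a \<in> carrier H \<Longrightarrow> \<sigma> \<one> a = a"
  using hom_one[OF hom K.is_group H.AutoGroup] by (simp add: AutoGroup_def BijGroup_def)

lemma \<sigma>_\<sigma>: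
  assumes "x \<in> carrier K" "y \<in> carrier K" "a \<in> carrier H"
  shows "\<sigma> x (\<sigma> y a) = \<sigma> (x \<otimes> y) a"
proof -
  have "\<sigma> (x \<otimes> y) = compose (carrier H) (\<sigma> x) (\<sigma> y)"
    using hom_mult[OF hom assms(1,2)] \<sigma>_auto assms
    by (simp add: AutoGroup_def BijGroup_def auto_def)
  then show ?thesis using assms by (simp add: compose_def)
qed

lemma K_conj_closed [simp]: "x \<in> carrier K \<Longrightarrow> y \<in> carrier K \<Longrightarrow> x \<rhd> y \<in> carrier K"
  by (simp add: conj_by_def)

declare K.lie_closed [simp]

lemma H_inv_mult_cancel [simp]: "a \<in> carrier H \<Longrightarrow> b \<in> carrier H \<Longrightarrow> a\<^sup>- \<cdot> (a \<cdot> b) = b"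
  by (simp add: H.m_assoc[symmetric])

lemma H_mult_inv_cancel [simp]: "a \<in> carrier H \<Longrightarrow> b \<in> carrier H \<Longrightarrow> a \<cdot> (a\<^sup>- \<cdot> b) = b"
  by (simp add: H.m_assoc[symmetric])

lemmas H_norm = H.m_ac H.inv_mult \<sigma>_H_mult \<sigma>_H_inv \<sigma>_\<sigma> conj_by_def[of K] K.m_assoc

text \<open>The multiplication is the crossed product of a factor set. The Lie operation is the
  value that \<open>lie_mult_lie_center\<close> forces on elements \<open>a t(x)\<close>: the
  inverse of \<open>a \<cdot> b\<close> is moved to the left past \<open>t(x \<star> y)\<close> and
  picks up the action.\<close>

definition cocycle_algebra :: "('k \<times> 'k \<Rightarrow> 'h) \<Rightarrow> ('k \<times> 'k \<Rightarrow> 'h) \<Rightarrow> ('h \<times> 'k) mlie" where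
  "cocycle_algebra f h =
    \<lparr>carrier = carrier H \<times> carrier K,
     mult = (\<lambda>(a, x) (b, y). (a \<cdot> \<sigma> x b \<cdot> f (x, y), x \<otimes> y)),
     one = (\<one>\<^bsub>H\<^esub>, \<one>),
     lie = (\<lambda>(a, x) (b, y). (a \<cdot> b \<cdot> \<sigma> (x \<star> y) (a\<^sup>- \<cdot> b\<^sup>-) \<cdot> h (x, y), x \<star> y))\<rparr>"

lemma cocycle_algebra_simps [simp]:
  "carrier (cocycle_algebra f h) = carrier H \<times> carrier K"
  "(a, x) \<otimes>\<^bsub>cocycle_algebra f h\<^esub> (b, y) = (a \<cdot> \<sigma> x b \<cdot> f (x, y), x \<otimes> y)"
  "\<one>\<^bsub>cocycle_algebra f h\<^esub> = (\<one>\<^bsub>H\<^esub>, \<one>)"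
  "(a, x) \<star>\<^bsub>cocycle_algebra f h\<^esub> (b, y) =
    (a \<cdot> b \<cdot> \<sigma> (x \<star> y) (a\<^sup>- \<cdot> b\<^sup>-) \<cdot> h (x, y), x \<star> y)"
  by (simp_all add: cocycle_algebra_def)

text \<open>Applied to both \<open>f\<close> and \<open>h\<close>. The condition on
  \<open>h (x, x)\<close> in L2 is left out, because it corresponds to the axiom
  \<open>lie_self\<close> of \<open>cocycle_algebra\<close>.\<close>

definition normalized :: "('k \<times> 'k \<Rightarrow> 'h) \<Rightarrow> bool" where
  "normalized f \<longleftrightarrow> f \<in> carrier K \<times> carrier K \<rightarrow>\<^sub>E carrier H \<and>
    (\<forall>x\<in>carrier K. f (\<one>, x) = \<one>\<^bsub>H\<^esub> \<and> f (x, \<one>) = \<one>\<^bsub>H\<^esub>)"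

lemma normalized_closed [simp]:
  "normalized f \<Longrightarrow> x \<in> carrier K \<Longrightarrow> y \<in> carrier K \<Longrightarrow> f (x, y) \<in> carrier H"
  by (auto simp: normalized_def)

lemma normalized_one [simp]:
  "normalized f \<Longrightarrow> x \<in> carrier K \<Longrightarrow> f (\<one>, x) = \<one>\<^bsub>H\<^esub>"
  "normalized f \<Longrightarrow> x \<in> carrier K \<Longrightarrow> f (x, \<one>) = \<one>\<^bsub>H\<^esub>"
  by (auto simp: normalized_def)

text \<open>Both \<open>H\<close>-components contain the factor \<open>?P\<close>, and cancelling it
  removes every occurrence of \<open>a\<close>, \<open>b\<close>, \<open>c\<close>. The
  \<open>K\<close>-components agree by associativity, and the normalization part of L1 is contained
  in \<open>normalized f\<close>.\<close>

lemma cocycle_algebra_assoc_iff: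
  assumes f: "normalized f" and xyz: "x \<in> carrier K" "y \<in> carrier K" "z \<in> carrier K"
    and abc: "a \<in> carrier H" "b \<in> carrier H" "c \<in> carrier H"
  shows "(a, x) \<otimes>\<^bsub>cocycle_algebra f h\<^esub> (b, y) \<otimes>\<^bsub>cocycle_algebra f h\<^esub> (c, z) =
      (a, x) \<otimes>\<^bsub>cocycle_algebra f h\<^esub> ((b, y) \<otimes>\<^bsub>cocycle_algebra f h\<^esub> (c, z)) \<longleftrightarrow>
    cocycle_L1 K H \<sigma> f x y z"
proof -
  let ?P = "a \<cdot> \<sigma> x b \<cdot> \<sigma> (x \<otimes> y) c"
  have "a \<cdot> \<sigma> x b \<cdot> f (x, y) \<cdot> \<sigma> (x \<otimes> y) c \<cdot> f (x \<otimes> y, z) =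
      ?P \<cdot> (f (x, y) \<cdot> f (x \<otimes> y, z))"
    using assms by (simp add: H_norm)
  moreover have "a \<cdot> \<sigma> x (b \<cdot> \<sigma> y c \<cdot> f (y, z)) \<cdot> f (x, y \<otimes> z) =
      ?P \<cdot> (\<sigma> x (f (y, z)) \<cdot> f (x, y \<otimes> z))"
    using assms by (simp add: H_norm)
  ultimately show ?thesis
    using assms by (simp add: cocycle_L1_def K.m_assoc)
qed

lemma group_cocycle_algebra_iff:
  assumes f: "normalized f"
  shows "group (cocycle_algebra f h) \<longleftrightarrow>
    (\<forall>x\<in>carrier K. \<forall>y\<in>carrier K. \<forall>z\<in>carrier K. cocycle_L1 K H \<sigma> f x y z)"
proof
  assume "group (cocycle_algebra f h)"
  then interpret M: group "cocycle_algebra f h" .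
  show "\<forall>x\<in>carrier K. \<forall>y\<in>carrier K. \<forall>z\<in>carrier K. cocycle_L1 K H \<sigma> f x y z"
  proof (intro ballI)
    fix x y z assume "x \<in> carrier K" "y \<in> carrier K" "z \<in> carrier K"
    \<comment> \<open>L1 has no parameters in \<open>H\<close>, so associativity on elements with
      trivial \<open>H\<close>-component already yields it.\<close>
    then show "cocycle_L1 K H \<sigma> f x y z"
      using M.m_assoc[of "(\<one>\<^bsub>H\<^esub>, x)" "(\<one>\<^bsub>H\<^esub>, y)" "(\<one>\<^bsub>H\<^esub>, z)"] f
      by (subst cocycle_algebra_assoc_iff[OF f, where h = h, symmetric]) auto
  qed
next
  assume L1: "\<forall>x\<in>carrier K. \<forall>y\<in>carrier K. \<forall>z\<in>carrier K. cocycle_L1 K H \<sigma> f x y z"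
  show "group (cocycle_algebra f h)"
  proof (rule groupI)
    fix p q r
    assume "p \<in> carrier (cocycle_algebra f h)" "q \<in> carrier (cocycle_algebra f h)"
      "r \<in> carrier (cocycle_algebra f h)"
    moreover obtain a x b y c z where "p = (a, x)" "q = (b, y)" "r = (c, z)"
      by (meson surj_pair)
    ultimately show "p \<otimes>\<^bsub>cocycle_algebra f h\<^esub> q \<otimes>\<^bsub>cocycle_algebra f h\<^esub> r =
        p \<otimes>\<^bsub>cocycle_algebra f h\<^esub> (q \<otimes>\<^bsub>cocycle_algebra f h\<^esub> r)"
      using L1 by (simp only:) (subst cocycle_algebra_assoc_iff[OF f], auto)
  next
    fix p assume "p \<in> carrier (cocycle_algebra f h)"
    then obtain a x where p: "p = (a, x)" "a \<in> carrier H" "x \<in> carrier K" by auto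
    \<comment> \<open>Obtained by solving \<open>?q \<otimes> p = \<one>\<close> for the first
      component, the second being forced to be \<open>inv x\<close>.\<close>
    let ?q = "((f (inv x, x))\<^sup>- \<cdot> \<sigma> (inv x) (a\<^sup>-), inv x)"
    have "?q \<otimes>\<^bsub>cocycle_algebra f h\<^esub> p = \<one>\<^bsub>cocycle_algebra f h\<^esub>"
      using p f by (simp add: \<sigma>_H_inv H.m_assoc)
    moreover have "?q \<in> carrier (cocycle_algebra f h)" using p f by simp
    ultimately show "\<exists>q\<in>carrier (cocycle_algebra f h).
        q \<otimes>\<^bsub>cocycle_algebra f h\<^esub> p = \<one>\<^bsub>cocycle_algebra f h\<^esub>" by blast
  qed (use f in auto)
qed

section \<open>Lie axioms and the conditions L3 to L6\<close>

context
  fixes f h assumes f: "normalized f" and h: "normalized h"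
    and M: "group (cocycle_algebra f h)"
begin

interpretation M: group "cocycle_algebra f h" by (rule M)

lemma cocycle_algebra_inv:
  assumes "a \<in> carrier H" "x \<in> carrier K"
  shows "inv\<^bsub>cocycle_algebra f h\<^esub> (a, x) = ((f (inv x, x))\<^sup>- \<cdot> \<sigma> (inv x) (a\<^sup>-), inv x)"
  using assms f by (intro M.inv_equality) (auto simp add: \<sigma>_H_inv H.m_assoc)

text \<open>The action of \<open>x \<otimes> y\<close> on the inverse is split, and its part in
  \<open>a\<close> becomes an action of \<open>x \<rhd> y\<close>. This is where the factors
  \<open>f (inv x, x)\<close> and \<open>f (x \<otimes> y, inv x)\<close> of L3 to L6 come
  from.\<close>

lemma cocycle_algebra_conj:
  assumes "a \<in> carrier H" "x \<in> carrier K" "b \<in> carrier H" "y \<in> carrier K"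
  shows "(a, x) \<rhd>\<^bsub>cocycle_algebra f h\<^esub> (b, y) =
    (a \<cdot> \<sigma> x b \<cdot> f (x, y) \<cdot> \<sigma> (x \<otimes> y) ((f (inv x, x))\<^sup>-) \<cdot> \<sigma> (x \<rhd> y) (a\<^sup>-) \<cdot> f (x \<otimes> y, inv x),
     x \<rhd> y)"
proof -
  have "\<sigma> (x \<otimes> y) ((f (inv x, x))\<^sup>- \<cdot> \<sigma> (inv x) (a\<^sup>-)) =
      \<sigma> (x \<otimes> y) ((f (inv x, x))\<^sup>-) \<cdot> \<sigma> (x \<rhd> y) (a\<^sup>-)"
    using assms f by (simp add: \<sigma>_H_mult \<sigma>_\<sigma> conj_by_def)
  then show ?thesis
    using assms f by (simp add: conj_by_def[of "cocycle_algebra f h"] cocycle_algebra_inv H.m_assoc)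
      (simp add: conj_by_def)
qed

context
  fixes x y z a b c
  assumes x [simp]: "x \<in> carrier K" and y [simp]: "y \<in> carrier K" and z [simp]: "z \<in> carrier K"
    and a [simp]: "a \<in> carrier H" and b [simp]: "b \<in> carrier H" and c [simp]: "c \<in> carrier H"
begin

text \<open>The \<open>K\<close>-components agree by the same axiom in \<open>K\<close>; the
  \<open>H\<close>-components share the factor \<open>a \<cdot> b\<close>, whose cancellation leaves
  L3.\<close>

lemma cocycle_algebra_lie_mult_right_iff:
  "(a, x) \<star>\<^bsub>cocycle_algebra f h\<^esub> ((b, y) \<otimes>\<^bsub>cocycle_algebra f h\<^esub> (c, z)) =
      ((a, x) \<star>\<^bsub>cocycle_algebra f h\<^esub> (b, y)) \<otimes>\<^bsub>cocycle_algebra f h\<^esub>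
      ((b, y) \<rhd>\<^bsub>cocycle_algebra f h\<^esub> ((a, x) \<star>\<^bsub>cocycle_algebra f h\<^esub> (c, z))) \<longleftrightarrow>
    cocycle_L3 K H \<sigma> f h x y z a b c" (is "?l = ?r \<longleftrightarrow> _")
proof -
  note [simp] = f h
  let ?h = "\<sigma> y (a \<cdot> c \<cdot> \<sigma> (x \<star> z) (a\<^sup>- \<cdot> c\<^sup>-) \<cdot> h (x, z)) \<cdot> f (y, x \<star> z)"
  let ?k = "\<sigma> (y \<otimes> (x \<star> z)) ((f (inv y, y))\<^sup>- \<cdot> \<sigma> (inv y) (b\<^sup>-)) \<cdot> f (y \<otimes> (x \<star> z), inv y)"
  have l: "fst ?l = (a \<cdot> b) \<cdot> (\<sigma> y c \<cdot> f (y, z) \<cdot>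
      \<sigma> (x \<star> (y \<otimes> z)) (a\<^sup>- \<cdot> b\<^sup>- \<cdot> \<sigma> y (c\<^sup>-) \<cdot> (f (y, z))\<^sup>-) \<cdot> h (x, y \<otimes> z))"
    by (simp add: H.m_ac H.inv_mult \<sigma>_H_inv)
  have r: "fst ?r = (a \<cdot> b) \<cdot>
      (\<sigma> (x \<star> y) (a\<^sup>- \<cdot> ?h \<cdot> ?k) \<cdot> f (x \<star> y, y \<rhd> (x \<star> z)) \<cdot> h (x, y))"
  proof -
    have *: "\<sigma> (y \<otimes> (x \<star> z)) ((f (inv y, y))\<^sup>-) \<cdot> \<sigma> (y \<rhd> (x \<star> z)) (b\<^sup>-) \<cdot> f (y \<otimes> (x \<star> z), inv y) = ?k"
      by (simp add: \<sigma>_H_mult \<sigma>_\<sigma> conj_by_def)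
    \<comment> \<open>The \<open>b\<close> contributed by the conjugation cancels
      \<open>b\<^sup>-\<close> under the same action, so only \<open>a\<^sup>-\<close> survives
      there in L3.\<close>
    have "\<sigma> (x \<star> y) (a\<^sup>- \<cdot> ?h \<cdot> ?k) = \<sigma> (x \<star> y) (a\<^sup>- \<cdot> b\<^sup>-) \<cdot> \<sigma> (x \<star> y) (b \<cdot> ?h \<cdot> ?k)"
      by (subst \<sigma>_H_mult[symmetric]) (simp_all add: H.m_assoc)
    moreover have "fst ?r = a \<cdot> b \<cdot> \<sigma> (x \<star> y) (a\<^sup>- \<cdot> b\<^sup>-) \<cdot> h (x, y) \<cdot>
        \<sigma> (x \<star> y) (b \<cdot> ?h \<cdot> ?k) \<cdot> f (x \<star> y, y \<rhd> (x \<star> z))"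
      by (simp add: cocycle_algebra_conj *[symmetric] H.m_assoc)
    ultimately show ?thesis by (simp add: H.m_ac)
  qed
  have s: "snd ?l = snd ?r"
    by (simp add: cocycle_algebra_conj K.lie_mult_right)
  show ?thesis
    unfolding prod_eq_iff l r s cocycle_L3_def
    by (subst H.Units_l_cancel) (auto simp: H.m_assoc)
qed

text \<open>Here the common factor of the \<open>H\<close>-components is
  \<open>a \<cdot> \<sigma> x b\<close>.\<close>

lemma cocycle_algebra_lie_mult_left_iff:
  "((a, x) \<otimes>\<^bsub>cocycle_algebra f h\<^esub> (b, y)) \<star>\<^bsub>cocycle_algebra f h\<^esub> (c, z) =
      ((a, x) \<rhd>\<^bsub>cocycle_algebra f h\<^esub> ((b, y) \<star>\<^bsub>cocycle_algebra f h\<^esub> (c, z)))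
      \<otimes>\<^bsub>cocycle_algebra f h\<^esub> ((a, x) \<star>\<^bsub>cocycle_algebra f h\<^esub> (c, z)) \<longleftrightarrow>
    cocycle_L4 K H \<sigma> f h x y z a b c" (is "?l = ?r \<longleftrightarrow> _")
proof -
  note [simp] = f h
  let ?h = "\<sigma> x (c \<cdot> \<sigma> (y \<star> z) (b\<^sup>- \<cdot> c\<^sup>-) \<cdot> h (y, z)) \<cdot> f (x, y \<star> z) \<cdot>
    \<sigma> (x \<otimes> (y \<star> z)) ((f (inv x, x))\<^sup>-) \<cdot> f (x \<otimes> (y \<star> z), inv x)"
  let ?k = "c \<cdot> \<sigma> (x \<star> z) (a\<^sup>- \<cdot> c\<^sup>-) \<cdot> h (x, z)"
  let ?F = "f (x \<rhd> (y \<star> z), x \<star> z)"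
  have l: "fst ?l = (a \<cdot> \<sigma> x b) \<cdot> (c \<cdot> f (x, y) \<cdot>
      \<sigma> ((x \<otimes> y) \<star> z) (a\<^sup>- \<cdot> c\<^sup>- \<cdot> \<sigma> x (b\<^sup>-) \<cdot> (f (x, y))\<^sup>-) \<cdot> h (x \<otimes> y, z))"
    by (simp add: H.m_ac H.inv_mult \<sigma>_H_inv)
  have r: "fst ?r = (a \<cdot> \<sigma> x b) \<cdot> (?h \<cdot> \<sigma> (x \<rhd> (y \<star> z)) ?k \<cdot> ?F)"
  proof -
    \<comment> \<open>The \<open>a\<^sup>-\<close> left by the conjugation and the leading
      \<open>a\<close> of the second Lie product stand under the same action and cancel.\<close>
    have "\<sigma> (x \<rhd> (y \<star> z)) ?k = \<sigma> (x \<rhd> (y \<star> z)) (a\<^sup>-) \<cdot> \<sigma> (x \<rhd> (y \<star> z)) (a \<cdot> ?k)"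
      by (subst \<sigma>_H_mult[symmetric]) simp_all
    moreover have "\<sigma> x (b \<cdot> c \<cdot> \<sigma> (y \<star> z) (b\<^sup>- \<cdot> c\<^sup>-) \<cdot> h (y, z)) =
        \<sigma> x b \<cdot> \<sigma> x (c \<cdot> \<sigma> (y \<star> z) (b\<^sup>- \<cdot> c\<^sup>-) \<cdot> h (y, z))"
      by (subst \<sigma>_H_mult[symmetric]) (simp_all add: H.m_assoc)
    ultimately show ?thesis
      by (simp add: cocycle_algebra_conj H.m_ac)
  qed
  have s: "snd ?l = snd ?r"
    by (simp add: cocycle_algebra_conj K.lie_mult_left)
  show ?thesis
    unfolding prod_eq_iff l r s cocycle_L4_def by (subst H.Units_l_cancel) simp_all
qed

text \<open>The common factor is \<open>c \<cdot> \<sigma> z a \<cdot> \<sigma> z b\<close>. Each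
  conjugate on the right contributes a \<open>c\<close>, so after cancelling, one \<open>c\<close>
  remains in front while both inverses remain under the action in L5.\<close>

lemma cocycle_algebra_lie_conj_iff:
  "(c, z) \<rhd>\<^bsub>cocycle_algebra f h\<^esub> ((a, x) \<star>\<^bsub>cocycle_algebra f h\<^esub> (b, y)) =
      ((c, z) \<rhd>\<^bsub>cocycle_algebra f h\<^esub> (a, x)) \<star>\<^bsub>cocycle_algebra f h\<^esub>
      ((c, z) \<rhd>\<^bsub>cocycle_algebra f h\<^esub> (b, y)) \<longleftrightarrow>
    cocycle_L5 K H \<sigma> f h x y z a b c" (is "?l = ?r \<longleftrightarrow> _")
proof -
  note [simp] = f h
  let ?L = "\<sigma> z (\<sigma> (x \<star> y) (a\<^sup>- \<cdot> b\<^sup>-) \<cdot> h (x, y)) \<cdot> f (z, x \<star> y)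
      \<cdot> \<sigma> (z \<otimes> (x \<star> y)) ((f (inv z, z))\<^sup>- \<cdot> \<sigma> (inv z) (c\<^sup>-))
      \<cdot> f (z \<otimes> (x \<star> y), inv z)"
  let ?R = "c \<cdot> f (z, x) \<cdot> f (z, y)
      \<cdot> \<sigma> (z \<otimes> x) ((f (inv z, z))\<^sup>-) \<cdot> \<sigma> (z \<otimes> y) ((f (inv z, z))\<^sup>-)
      \<cdot> \<sigma> (z \<rhd> x) (c\<^sup>-) \<cdot> \<sigma> (z \<rhd> y) (c\<^sup>-)
      \<cdot> f (z \<otimes> y, inv z) \<cdot> f (z \<otimes> x, inv z)
      \<cdot> \<sigma> ((z \<rhd> x) \<star> (z \<rhd> y))
          (c\<^sup>- \<cdot> c\<^sup>- \<cdot> \<sigma> z (a\<^sup>- \<cdot> b\<^sup>-) \<cdot> (f (z, x))\<^sup>- \<cdot> (f (z, y))\<^sup>-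
            \<cdot> \<sigma> (z \<otimes> x) (f (inv z, z)) \<cdot> \<sigma> (z \<otimes> y) (f (inv z, z))
            \<cdot> (f (z \<otimes> y, inv z))\<^sup>- \<cdot> (f (z \<otimes> x, inv z))\<^sup>-
            \<cdot> \<sigma> (z \<rhd> y) c \<cdot> \<sigma> (z \<rhd> x) c)
      \<cdot> h (z \<rhd> x, z \<rhd> y)"
  have l: "fst ?l = (c \<cdot> \<sigma> z a \<cdot> \<sigma> z b) \<cdot> ?L"
  proof -
    have "\<sigma> (z \<otimes> (x \<star> y)) ((f (inv z, z))\<^sup>- \<cdot> \<sigma> (inv z) (c\<^sup>-)) =
        \<sigma> (z \<otimes> (x \<star> y)) ((f (inv z, z))\<^sup>-) \<cdot> \<sigma> (z \<rhd> (x \<star> y)) (c\<^sup>-)"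
      by (simp add: \<sigma>_H_mult \<sigma>_\<sigma> conj_by_def)
    then show ?thesis
      by (simp add: cocycle_algebra_conj H.m_ac \<sigma>_H_mult)
  qed
  have r: "fst ?r = (c \<cdot> \<sigma> z a \<cdot> \<sigma> z b) \<cdot> ?R"
    by (simp add: cocycle_algebra_conj H.m_ac H.inv_mult \<sigma>_H_mult \<sigma>_H_inv)
  have s: "snd ?l = snd ?r"
    by (simp add: cocycle_algebra_conj K.lie_conj)
  show ?thesis
    unfolding prod_eq_iff l r s cocycle_L5_def by (subst H.Units_l_cancel) simp_all
qed

text \<open>The right-hand side is the identity, so nothing is cancelled: L6 is the
  \<open>H\<close>-component of the equation itself, with \<open>A\<close>, \<open>B\<close>,
  \<open>C\<close> the cyclic shifts of one expression.\<close>

lemma cocycle_algebra_jacobi_iff: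
  "((a, x) \<star>\<^bsub>cocycle_algebra f h\<^esub> (b, y)) \<star>\<^bsub>cocycle_algebra f h\<^esub>
        ((b, y) \<rhd>\<^bsub>cocycle_algebra f h\<^esub> (c, z)) \<otimes>\<^bsub>cocycle_algebra f h\<^esub>
      (((b, y) \<star>\<^bsub>cocycle_algebra f h\<^esub> (c, z)) \<star>\<^bsub>cocycle_algebra f h\<^esub>
        ((c, z) \<rhd>\<^bsub>cocycle_algebra f h\<^esub> (a, x))) \<otimes>\<^bsub>cocycle_algebra f h\<^esub>
      (((c, z) \<star>\<^bsub>cocycle_algebra f h\<^esub> (a, x)) \<star>\<^bsub>cocycle_algebra f h\<^esub>
        ((a, x) \<rhd>\<^bsub>cocycle_algebra f h\<^esub> (b, y))) = \<one>\<^bsub>cocycle_algebra f h\<^esub> \<longleftrightarrow>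
    cocycle_L6 K H \<sigma> f h x y z a b c"
proof -
  note [simp] = f h
  \<comment> \<open>A Lie product depends on the \<open>H\<close>-components of its arguments only
    through their product. For an outer Lie product this is \<open>T\<close>, whose three cyclic
    shifts are \<open>A\<close>, \<open>B\<close>, \<open>C\<close>, so one computation serves all
    three factors.\<close>
  define T where "T a b c x y z = a \<cdot> b \<cdot> b \<cdot> \<sigma> (x \<star> y) (a\<^sup>- \<cdot> b\<^sup>-) \<cdot> h (x, y) \<cdot> \<sigma> y c \<cdot> f (y, z)
           \<cdot> \<sigma> (y \<otimes> z) ((f (inv y, y))\<^sup>-) \<cdot> f (y \<otimes> z, inv y) \<cdot> \<sigma> (y \<rhd> z) (b\<^sup>-)" for a b c x y z
  define u where "u x y z = (x \<star> y) \<star> (y \<rhd> z)" for x y z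
  have T: "T a b c x y z \<in> carrier H" "u x y z \<in> carrier K"
    if "x \<in> carrier K" "y \<in> carrier K" "z \<in> carrier K" "a \<in> carrier H" "b \<in> carrier H" "c \<in> carrier H"
    for a b c x y z
    using that by (simp_all add: T_def u_def)
  have summand: "((a, x) \<star>\<^bsub>cocycle_algebra f h\<^esub> (b, y)) \<star>\<^bsub>cocycle_algebra f h\<^esub>
        ((b, y) \<rhd>\<^bsub>cocycle_algebra f h\<^esub> (c, z)) =
      (T a b c x y z \<cdot> \<sigma> (u x y z) ((T a b c x y z)\<^sup>-) \<cdot> h (x \<star> y, y \<rhd> z), u x y z)"
    if "x \<in> carrier K" "y \<in> carrier K" "z \<in> carrier K" "a \<in> carrier H" "b \<in> carrier H" "c \<in> carrier H"
    for a b c x y z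
  proof -
    let ?p = "a \<cdot> b \<cdot> \<sigma> (x \<star> y) (a\<^sup>- \<cdot> b\<^sup>-) \<cdot> h (x, y)"
    let ?q = "b \<cdot> \<sigma> y c \<cdot> f (y, z) \<cdot> \<sigma> (y \<otimes> z) ((f (inv y, y))\<^sup>-) \<cdot> \<sigma> (y \<rhd> z) (b\<^sup>-) \<cdot> f (y \<otimes> z, inv y)"
    have "?p \<cdot> ?q = T a b c x y z" unfolding T_def using that by (simp add: H.m_ac)
    moreover have "?p\<^sup>- \<cdot> ?q\<^sup>- = (?p \<cdot> ?q)\<^sup>-" using that by (simp add: H.inv_mult)
    ultimately show ?thesis
      using that by (simp add: cocycle_algebra_conj u_def del: H.inv_mult)
  qed
  note T = T[OF x y z a b c] T[OF y z x b c a] T[OF z x y c a b]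
  \<comment> \<open>This settles the \<open>K\<close>-component, so only the
    \<open>H\<close>-component remains to be compared with L6.\<close>
  have "u x y z \<otimes> u y z x \<otimes> u z x y = \<one>"
    by (simp add: u_def K.lie_jacobi)
  then show ?thesis
    using T
    unfolding summand[OF x y z a b c] summand[OF y z x b c a] summand[OF z x y c a b] cocycle_L6_def Let_def
      u_def[symmetric] T_def[symmetric]
    by simp
qed

end
end

text \<open>The dictionary: L1 gives the group structure and the normalization of \<open>f\<close>,
  L2 the normalization of \<open>h\<close> and \<open>lie_self\<close>, and L3 to L6 the other Lie
  identities. Arguments about cocycles below use the algebra in place of the identities.\<close>

lemma Z2_ML_iff:
  "(f, h, \<sigma>) \<in> Z2_ML K H \<sigma> \<longleftrightarrow>
    normalized f \<and> normalized h \<and> mult_lie_algebra (cocycle_algebra f h)"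
proof
  assume Z: "(f, h, \<sigma>) \<in> Z2_ML K H \<sigma>"
  then have fh: "f \<in> carrier K \<times> carrier K \<rightarrow>\<^sub>E carrier H" "h \<in> carrier K \<times> carrier K \<rightarrow>\<^sub>E carrier H"
    and L12: "\<And>x y z. x \<in> carrier K \<Longrightarrow> y \<in> carrier K \<Longrightarrow> z \<in> carrier K \<Longrightarrow>
        cocycle_L1 K H \<sigma> f x y z \<and> cocycle_L2 K H h x"
    and L: "\<And>x y z a b c. x \<in> carrier K \<Longrightarrow> y \<in> carrier K \<Longrightarrow> z \<in> carrier K \<Longrightarrow>
        a \<in> carrier H \<Longrightarrow> b \<in> carrier H \<Longrightarrow> c \<in> carrier H \<Longrightarrow>
        cocycle_L3 K H \<sigma> f h x y z a b c \<and> cocycle_L4 K H \<sigma> f h x y z a b c \<and>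
        cocycle_L5 K H \<sigma> f h x y z a b c \<and> cocycle_L6 K H \<sigma> f h x y z a b c"
    unfolding Z2_ML_def by auto
  have one: "f (\<one>, x) = \<one>\<^bsub>H\<^esub> \<and> f (x, \<one>) = \<one>\<^bsub>H\<^esub> \<and> h (\<one>, x) = \<one>\<^bsub>H\<^esub> \<and> h (x, \<one>) = \<one>\<^bsub>H\<^esub>"
    if "x \<in> carrier K" for x
    using L12[OF that that that] unfolding cocycle_L1_def cocycle_L2_def by blast
  have f: "normalized f"
    unfolding normalized_def using fh(1) one by blast
  have h: "normalized h"
    unfolding normalized_def using fh(2) one by blast
  \<comment> \<open>The group structure comes first: the equivalences for L3 to L6 involve
    conjugation, hence inverses, and are stated under it.\<close>
  have M: "group (cocycle_algebra f h)"
    unfolding group_cocycle_algebra_iff[OF f] by (intro ballI L12[THEN conjunct1])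
  have hxx: "h (x, x) = \<one>\<^bsub>H\<^esub>" if "x \<in> carrier K" for x
    using L12[OF that that that] by (simp add: cocycle_L2_def)
  have "mult_lie_algebra (cocycle_algebra f h)"
  proof (rule mult_lie_algebra.intro[OF M], rule mult_lie_algebra_axioms.intro)
    fix p q r
    assume "p \<in> carrier (cocycle_algebra f h)"
    then obtain a x where p: "p = (a, x)" "a \<in> carrier H" "x \<in> carrier K" by auto
    show "p \<star>\<^bsub>cocycle_algebra f h\<^esub> p = \<one>\<^bsub>cocycle_algebra f h\<^esub>"
      using p by (simp add: K.lie_self hxx) (simp add: H.m_ac)
    assume "q \<in> carrier (cocycle_algebra f h)"
    then obtain b y where q: "q = (b, y)" "b \<in> carrier H" "y \<in> carrier K" by auto
    show "p \<star>\<^bsub>cocycle_algebra f h\<^esub> q \<in> carrier (cocycle_algebra f h)"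
      using p q h by simp
    assume "r \<in> carrier (cocycle_algebra f h)"
    then obtain c z where r: "r = (c, z)" "c \<in> carrier H" "z \<in> carrier K" by auto
    note prems = p(3) q(3) r(3) p(2) q(2) r(2)
    note L = L[OF prems]
    note rules = cocycle_algebra_lie_mult_right_iff[OF f h M prems]
      cocycle_algebra_lie_mult_left_iff[OF f h M prems]
      cocycle_algebra_lie_conj_iff[OF f h M prems]
      cocycle_algebra_jacobi_iff[OF f h M prems]
    show "p \<star>\<^bsub>cocycle_algebra f h\<^esub> (q \<otimes>\<^bsub>cocycle_algebra f h\<^esub> r) =
        (p \<star>\<^bsub>cocycle_algebra f h\<^esub> q) \<otimes>\<^bsub>cocycle_algebra f h\<^esub>
        (q \<rhd>\<^bsub>cocycle_algebra f h\<^esub> (p \<star>\<^bsub>cocycle_algebra f h\<^esub> r))"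
      using rules L unfolding p(1) q(1) r(1) by blast
    show "(p \<otimes>\<^bsub>cocycle_algebra f h\<^esub> q) \<star>\<^bsub>cocycle_algebra f h\<^esub> r =
        (p \<rhd>\<^bsub>cocycle_algebra f h\<^esub> (q \<star>\<^bsub>cocycle_algebra f h\<^esub> r)) \<otimes>\<^bsub>cocycle_algebra f h\<^esub>
        (p \<star>\<^bsub>cocycle_algebra f h\<^esub> r)"
      using rules L unfolding p(1) q(1) r(1) by blast
    show "r \<rhd>\<^bsub>cocycle_algebra f h\<^esub> (p \<star>\<^bsub>cocycle_algebra f h\<^esub> q) =
        (r \<rhd>\<^bsub>cocycle_algebra f h\<^esub> p) \<star>\<^bsub>cocycle_algebra f h\<^esub> (r \<rhd>\<^bsub>cocycle_algebra f h\<^esub> q)"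
      using rules L unfolding p(1) q(1) r(1) by blast
    show "((p \<star>\<^bsub>cocycle_algebra f h\<^esub> q) \<star>\<^bsub>cocycle_algebra f h\<^esub> (q \<rhd>\<^bsub>cocycle_algebra f h\<^esub> r))
        \<otimes>\<^bsub>cocycle_algebra f h\<^esub>
        ((q \<star>\<^bsub>cocycle_algebra f h\<^esub> r) \<star>\<^bsub>cocycle_algebra f h\<^esub> (r \<rhd>\<^bsub>cocycle_algebra f h\<^esub> p))
        \<otimes>\<^bsub>cocycle_algebra f h\<^esub>
        ((r \<star>\<^bsub>cocycle_algebra f h\<^esub> p) \<star>\<^bsub>cocycle_algebra f h\<^esub> (p \<rhd>\<^bsub>cocycle_algebra f h\<^esub> q)) =
        \<one>\<^bsub>cocycle_algebra f h\<^esub>"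
      using rules L unfolding p(1) q(1) r(1) by blast
  qed
  with f h show "normalized f \<and> normalized h \<and> mult_lie_algebra (cocycle_algebra f h)" by blast
next
  assume "normalized f \<and> normalized h \<and> mult_lie_algebra (cocycle_algebra f h)"
  then have f: "normalized f" and h: "normalized h"
    and "mult_lie_algebra (cocycle_algebra f h)" by auto
  then interpret M: mult_lie_algebra "cocycle_algebra f h" by simp
  have M: "group (cocycle_algebra f h)" by (rule M.is_group)
  show "(f, h, \<sigma>) \<in> Z2_ML K H \<sigma>"
    unfolding Z2_ML_def
  proof (intro CollectI exI conjI ballI)
    show "(f, h, \<sigma>) = (f, h, \<sigma>)" ..
    show "f \<in> carrier K \<times> carrier K \<rightarrow>\<^sub>E carrier H" "h \<in> carrier K \<times> carrier K \<rightarrow>\<^sub>E carrier H"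
      using f h unfolding normalized_def by blast+
  next
    fix x y z assume prems: "x \<in> carrier K" "y \<in> carrier K" "z \<in> carrier K"
    show "cocycle_L1 K H \<sigma> f x y z"
      using group_cocycle_algebra_iff[OF f] M prems by blast
    show "cocycle_L2 K H h x"
      \<comment> \<open>At an element with trivial \<open>H\<close>-component,
        \<open>lie_self\<close> reads off exactly the value of \<open>h (x, x)\<close>.\<close>
      using h prems M.lie_self[of "(\<one>\<^bsub>H\<^esub>, x)"]
      by (simp add: cocycle_L2_def)
    fix a b c assume abc: "a \<in> carrier H" "b \<in> carrier H" "c \<in> carrier H"
    note prems = prems abc
    have mem: "(a, x) \<in> carrier (cocycle_algebra f h)" "(b, y) \<in> carrier (cocycle_algebra f h)"
      "(c, z) \<in> carrier (cocycle_algebra f h)" using prems by simp_all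
    show "cocycle_L3 K H \<sigma> f h x y z a b c"
      using cocycle_algebra_lie_mult_right_iff[OF f h M prems] M.lie_mult_right[OF mem] by blast
    show "cocycle_L4 K H \<sigma> f h x y z a b c"
      using cocycle_algebra_lie_mult_left_iff[OF f h M prems] M.lie_mult_left[OF mem] by blast
    show "cocycle_L5 K H \<sigma> f h x y z a b c"
      using cocycle_algebra_lie_conj_iff[OF f h M prems] M.lie_conj[OF mem] by blast
    show "cocycle_L6 K H \<sigma> f h x y z a b c"
      using cocycle_algebra_jacobi_iff[OF f h M prems] M.lie_jacobi[OF mem] by blast
  qed
qed

section \<open>Equivalence and coboundaries\<close>

definition cocycle_extension ::
    "('k \<times> 'k \<Rightarrow> 'h) \<Rightarrow> ('k \<times> 'k \<Rightarrow> 'h) \<Rightarrow> ('h, 'h \<times> 'k, 'k) extension" where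
  "cocycle_extension f h = \<lparr>mid = cocycle_algebra f h, incl = (\<lambda>a. (a, \<one>)), proj = snd\<rparr>"

lemma cocycle_extension_simps [simp]:
  "mid (cocycle_extension f h) = cocycle_algebra f h"
  "incl (cocycle_extension f h) a = (a, \<one>)"
  "proj (cocycle_extension f h) = snd"
  by (simp_all add: cocycle_extension_def)

text \<open>
  The two sides of the left-hand equation are the \<open>H\<close>-components of \<open>\<psi> (p q)\<close> and \<open>\<psi> p \<psi> q\<close> for
  \<open>\<psi> (a, x) = (a g(x), x)\<close>, \<open>p = (a, x)\<close> and \<open>q = (b, y)\<close>; similarly for the Lie operation.
\<close>

lemma shift_mult_iff:
  assumes f: "normalized f" "normalized f'" and g: "g \<in> carrier K \<rightarrow> carrier H"
    and xy: "x \<in> carrier K" "y \<in> carrier K" and ab: "a \<in> carrier H" "b \<in> carrier H"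
  shows "a \<cdot> \<sigma> x b \<cdot> f' (x, y) \<cdot> g (x \<otimes> y) = a \<cdot> g x \<cdot> \<sigma> x (b \<cdot> g y) \<cdot> f (x, y) \<longleftrightarrow>
    f' (x, y) = coboundary_mult K H \<sigma> g (x, y) \<cdot> f (x, y)"
proof -
  have [simp]: "g x \<in> carrier H" "g y \<in> carrier H" "g (x \<otimes> y) \<in> carrier H"
    using g xy by auto
  note [simp] = f xy ab
  have l: "a \<cdot> \<sigma> x b \<cdot> f' (x, y) \<cdot> g (x \<otimes> y) = (a \<cdot> \<sigma> x b \<cdot> g (x \<otimes> y)) \<cdot> f' (x, y)"
    by (simp add: H.m_ac)
  have r: "a \<cdot> g x \<cdot> \<sigma> x (b \<cdot> g y) \<cdot> f (x, y) =
      (a \<cdot> \<sigma> x b \<cdot> g (x \<otimes> y)) \<cdot> (coboundary_mult K H \<sigma> g (x, y) \<cdot> f (x, y))"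
  proof -
    \<comment> \<open>The inverse pair is kept as a separate factor, and cancellation is switched
      off, so that both sides are rearrangements of the same factors; the pair is removed
      afterwards.\<close>
    have "(a \<cdot> \<sigma> x b \<cdot> g (x \<otimes> y)) \<cdot> (coboundary_mult K H \<sigma> g (x, y) \<cdot> f (x, y)) =
      ((g (x \<otimes> y))\<^sup>- \<cdot> g (x \<otimes> y)) \<cdot> (a \<cdot> g x \<cdot> \<sigma> x b \<cdot> \<sigma> x (g y) \<cdot> f (x, y))"
      by (simp only: coboundary_mult_def restrict_apply mem_Sigma_iff prod.case xy simp_thms if_True)
        (simp add: H.m_ac del: H_inv_mult_cancel H.l_inv H.Units_l_inv)
    then show ?thesis by (simp add: \<sigma>_H_mult H.m_ac)
  qed
  show ?thesis
    unfolding l r by (subst H.Units_l_cancel) (simp_all add: coboundary_mult_def)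
qed

lemma shift_lie_iff:
  assumes h: "normalized h" "normalized h'" and g: "g \<in> carrier K \<rightarrow> carrier H"
    and xy: "x \<in> carrier K" "y \<in> carrier K" and ab: "a \<in> carrier H" "b \<in> carrier H"
  shows "a \<cdot> b \<cdot> \<sigma> (x \<star> y) (a\<^sup>- \<cdot> b\<^sup>-) \<cdot> h' (x, y) \<cdot> g (x \<star> y) =
      a \<cdot> g x \<cdot> (b \<cdot> g y) \<cdot> \<sigma> (x \<star> y) ((a \<cdot> g x)\<^sup>- \<cdot> (b \<cdot> g y)\<^sup>-) \<cdot> h (x, y) \<longleftrightarrow>
    h' (x, y) = coboundary_lie K H \<sigma> g (x, y) \<cdot> h (x, y)"
proof -
  have [simp]: "g x \<in> carrier H" "g y \<in> carrier H" "g (x \<star> y) \<in> carrier H"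
    using g xy by auto
  note [simp] = h xy ab
  let ?P = "a \<cdot> b \<cdot> \<sigma> (x \<star> y) (a\<^sup>- \<cdot> b\<^sup>-) \<cdot> g (x \<star> y)"
  have l: "a \<cdot> b \<cdot> \<sigma> (x \<star> y) (a\<^sup>- \<cdot> b\<^sup>-) \<cdot> h' (x, y) \<cdot> g (x \<star> y) = ?P \<cdot> h' (x, y)"
    by (simp add: H.m_ac)
  have r: "a \<cdot> g x \<cdot> (b \<cdot> g y) \<cdot> \<sigma> (x \<star> y) ((a \<cdot> g x)\<^sup>- \<cdot> (b \<cdot> g y)\<^sup>-) \<cdot> h (x, y) =
      ?P \<cdot> (coboundary_lie K H \<sigma> g (x, y) \<cdot> h (x, y))"
  proof -
    have "?P \<cdot> (coboundary_lie K H \<sigma> g (x, y) \<cdot> h (x, y)) = ((g (x \<star> y))\<^sup>- \<cdot> g (x \<star> y)) \<cdot>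
      (a \<cdot> b \<cdot> g x \<cdot> g y \<cdot> (\<sigma> (x \<star> y) (a\<^sup>- \<cdot> b\<^sup>-) \<cdot> \<sigma> (x \<star> y) ((g x)\<^sup>- \<cdot> (g y)\<^sup>-)) \<cdot> h (x, y))"
      by (simp only: coboundary_lie_def restrict_apply mem_Sigma_iff prod.case xy simp_thms if_True)
        (simp add: H.m_ac del: H_inv_mult_cancel H.l_inv H.Units_l_inv)
    then show ?thesis by (simp add: \<sigma>_H_mult H.inv_mult H.m_ac)
  qed
  show ?thesis
    unfolding l r by (subst H.Units_l_cancel) (simp_all add: coboundary_lie_def)
qed

text \<open>Both sides consist of functions extensional on
  \<open>carrier K \<times> carrier K\<close>, so their values there decide equality.\<close>

lemma cochain_eq_coboundary_mult_iff:
  assumes "normalized f" "normalized f'" "normalized h" "normalized h'"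
  shows "(f', h', \<sigma>) = cochain_mult K H (coboundary_mult K H \<sigma> g, coboundary_lie K H \<sigma> g, \<sigma>) (f, h, \<sigma>) \<longleftrightarrow>
    (\<forall>x\<in>carrier K. \<forall>y\<in>carrier K. f' (x, y) = coboundary_mult K H \<sigma> g (x, y) \<cdot> f (x, y) \<and>
      h' (x, y) = coboundary_lie K H \<sigma> g (x, y) \<cdot> h (x, y))" (is "?l = ?r")
proof
  assume ?l
  then have "f' = (\<lambda>p \<in> carrier K \<times> carrier K. coboundary_mult K H \<sigma> g p \<cdot> f p)"
    "h' = (\<lambda>p \<in> carrier K \<times> carrier K. coboundary_lie K H \<sigma> g p \<cdot> h p)" by simp_all
  then show ?r by simp
next
  assume ?r
  have ext: "f' \<in> extensional (carrier K \<times> carrier K)" "h' \<in> extensional (carrier K \<times> carrier K)"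
    using assms unfolding normalized_def PiE_def by blast+
  have "f' = (\<lambda>p \<in> carrier K \<times> carrier K. coboundary_mult K H \<sigma> g p \<cdot> f p)"
    by (rule extensionalityI[OF ext(1) restrict_extensional]) (use \<open>?r\<close> in auto)
  moreover have "h' = (\<lambda>p \<in> carrier K \<times> carrier K. coboundary_lie K H \<sigma> g p \<cdot> h p)"
    by (rule extensionalityI[OF ext(2) restrict_extensional]) (use \<open>?r\<close> in auto)
  ultimately show ?l by simp
qed

text \<open>An equivalence fixes each \<open>(a, \<one>)\<close> and all second components, hence is
  the shift by some \<open>g\<close>. It starts at the primed algebra, since a shift in that
  direction expresses \<open>f'\<close> and \<open>h'\<close> through \<open>f\<close> and
  \<open>h\<close>.\<close>

lemma ext_equiv_cocycle_extension_iff: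
  assumes Z: "(f, h, \<sigma>) \<in> Z2_ML K H \<sigma>" and Z': "(f', h', \<sigma>) \<in> Z2_ML K H \<sigma>"
  shows "ext_equiv H K (cocycle_extension f' h') (cocycle_extension f h) \<longleftrightarrow>
    (\<exists>b\<in>B2_ML K H \<sigma>. (f', h', \<sigma>) = cochain_mult K H b (f, h, \<sigma>))"
proof -
  have f: "normalized f" "normalized f'" and h: "normalized h" "normalized h'"
    using Z Z' by (simp_all add: Z2_ML_iff)
  interpret M: mult_lie_algebra "cocycle_algebra f h" using Z by (simp add: Z2_ML_iff)
  interpret M': mult_lie_algebra "cocycle_algebra f' h'" using Z' by (simp add: Z2_ML_iff)
  note [simp] = f h
  show ?thesis
  proof
    assume "ext_equiv H K (cocycle_extension f' h') (cocycle_extension f h)"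
    then obtain \<psi> where \<psi>: "\<psi> \<in> mlie_iso (cocycle_algebra f' h') (cocycle_algebra f h)"
      and incl: "\<And>a. a \<in> carrier H \<Longrightarrow> \<psi> (a, \<one>) = (a, \<one>)"
      and proj: "\<And>a x. a \<in> carrier H \<Longrightarrow> x \<in> carrier K \<Longrightarrow> snd (\<psi> (a, x)) = x"
      by (auto simp: ext_equiv_def)
    from \<psi> have hom: "\<psi> \<in> hom (cocycle_algebra f' h') (cocycle_algebra f h)"
      and lie: "\<And>p q. p \<in> carrier (cocycle_algebra f' h') \<Longrightarrow> q \<in> carrier (cocycle_algebra f' h') \<Longrightarrow>
        \<psi> (p \<star>\<^bsub>cocycle_algebra f' h'\<^esub> q) = \<psi> p \<star>\<^bsub>cocycle_algebra f h\<^esub> \<psi> q"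
      unfolding mlie_iso_def mlie_hom_def by blast+
    define g where "g x = fst (\<psi> (\<one>\<^bsub>H\<^esub>, x))" for x
    have g1: "\<psi> (\<one>\<^bsub>H\<^esub>, x) = (g x, x)" if "x \<in> carrier K" for x
      using proj[OF _ that] by (simp add: g_def prod_eq_iff)
    have gc [simp]: "g x \<in> carrier H" if "x \<in> carrier K" for x
      using hom_in_carrier[OF hom, of "(\<one>\<^bsub>H\<^esub>, x)"] g1[OF that] that by simp
    \<comment> \<open>By normalization \<open>(a, x)\<close> is the product of
      \<open>(a, \<one>)\<close> and \<open>(\<one>, x)\<close>, so \<open>\<psi>\<close> is
      determined by \<open>g\<close>.\<close>
    have \<psi>_eq: "\<psi> (a, x) = (a \<cdot> g x, x)" if "a \<in> carrier H" "x \<in> carrier K" for a x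
      using hom_mult[OF hom, of "(a, \<one>)" "(\<one>\<^bsub>H\<^esub>, x)"] that by (simp add: incl g1)
    have g: "g \<in> carrier K \<rightarrow> carrier H" by simp
    have "f' (x, y) = coboundary_mult K H \<sigma> g (x, y) \<cdot> f (x, y) \<and>
        h' (x, y) = coboundary_lie K H \<sigma> g (x, y) \<cdot> h (x, y)"
      if xy: "x \<in> carrier K" "y \<in> carrier K" for x y
    proof
      \<comment> \<open>The coboundary relations are free of \<open>a\<close> and \<open>b\<close>,
        so evaluating at trivial \<open>H\<close>-components suffices.\<close>
      show "f' (x, y) = coboundary_mult K H \<sigma> g (x, y) \<cdot> f (x, y)"
        using hom_mult[OF hom, of "(\<one>\<^bsub>H\<^esub>, x)" "(\<one>\<^bsub>H\<^esub>, y)"] xy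
        by (subst shift_mult_iff[OF f g xy H.one_closed H.one_closed, symmetric]) (simp add: \<psi>_eq)
      show "h' (x, y) = coboundary_lie K H \<sigma> g (x, y) \<cdot> h (x, y)"
        using lie[of "(\<one>\<^bsub>H\<^esub>, x)" "(\<one>\<^bsub>H\<^esub>, y)"] xy
        by (subst shift_lie_iff[OF h g xy H.one_closed H.one_closed, symmetric]) (simp add: \<psi>_eq)
    qed
    then have "(f', h', \<sigma>) =
        cochain_mult K H (coboundary_mult K H \<sigma> g, coboundary_lie K H \<sigma> g, \<sigma>) (f, h, \<sigma>)"
      by (subst cochain_eq_coboundary_mult_iff[OF f h]) blast
    moreover have "g \<one> = \<one>\<^bsub>H\<^esub>" using incl by (simp add: g_def)
    ultimately show "\<exists>b\<in>B2_ML K H \<sigma>. (f', h', \<sigma>) = cochain_mult K H b (f, h, \<sigma>)"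
      using g unfolding B2_ML_def by blast
  next
    assume "\<exists>b\<in>B2_ML K H \<sigma>. (f', h', \<sigma>) = cochain_mult K H b (f, h, \<sigma>)"
    then obtain g where g: "g \<in> carrier K \<rightarrow> carrier H" and g1: "g \<one> = \<one>\<^bsub>H\<^esub>" and
      "(f', h', \<sigma>) =
        cochain_mult K H (coboundary_mult K H \<sigma> g, coboundary_lie K H \<sigma> g, \<sigma>) (f, h, \<sigma>)"
      unfolding B2_ML_def by blast
    then have eq: "f' (x, y) = coboundary_mult K H \<sigma> g (x, y) \<cdot> f (x, y)"
        "h' (x, y) = coboundary_lie K H \<sigma> g (x, y) \<cdot> h (x, y)"
      if "x \<in> carrier K" "y \<in> carrier K" for x y
      using that cochain_eq_coboundary_mult_iff[OF f h] by blast+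
    have gc [simp]: "g x \<in> carrier H" if "x \<in> carrier K" for x using g that by auto
    define \<psi> where "\<psi> = (\<lambda>(a, x). (a \<cdot> g x, x))"
    have "bij_betw \<psi> (carrier H \<times> carrier K) (carrier H \<times> carrier K)"
      by (rule bij_betw_byWitness[where f' = "\<lambda>(a, x). (a \<cdot> (g x)\<^sup>-, x)"])
        (auto simp: \<psi>_def H.m_assoc)
    then have "\<psi> \<in> mlie_iso (cocycle_algebra f' h') (cocycle_algebra f h)"
      by (auto simp: mlie_iso_def mlie_hom_def \<psi>_def intro!: homI
          shift_mult_iff[OF f g, THEN iffD2, OF _ _ _ _ eq(1)]
          shift_lie_iff[OF h g, THEN iffD2, OF _ _ _ _ eq(2)])
    then show "ext_equiv H K (cocycle_extension f' h') (cocycle_extension f h)"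
      unfolding ext_equiv_def by (intro bexI[of _ \<psi>]) (auto simp: \<psi>_def g1)
  qed
qed

section \<open>Extensions and their cocycles\<close>

context
  fixes E :: "('h, 'g, 'k) extension"
  assumes E: "is_lie_center_extension H K E"
begin

interpretation G: mult_lie_algebra "mid E"
  using E by (simp add: is_lie_center_extension_def is_extension_def)

interpretation i: group_hom H "mid E" "incl E"
  using E by (auto simp: is_lie_center_extension_def is_extension_def mlie_hom_def
      group_hom_def group_hom_axioms_def)

interpretation p: group_hom "mid E" K "proj E"
  using E by (auto simp: is_lie_center_extension_def is_extension_def mlie_hom_def
      group_hom_def group_hom_axioms_def)

lemma proj_lie:
  "g \<in> carrier (mid E) \<Longrightarrow> k \<in> carrier (mid E) \<Longrightarrow>
    proj E (g \<star>\<^bsub>mid E\<^esub> k) = proj E g \<star> proj E k"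
  using E by (auto simp: is_lie_center_extension_def is_extension_def mlie_hom_def)

lemma incl_in_lie_center: "a \<in> carrier H \<Longrightarrow> incl E a \<in> lie_center (mid E)"
  using E by (auto simp: is_lie_center_extension_def)

lemma incl_eq_iff: "a \<in> carrier H \<Longrightarrow> b \<in> carrier H \<Longrightarrow> incl E a = incl E b \<longleftrightarrow> a = b"
  using E by (auto simp: is_lie_center_extension_def is_extension_def inj_on_def)

lemma incl_image: "incl E ` carrier H = {g \<in> carrier (mid E). proj E g = \<one>}"
  using E by (auto simp: is_lie_center_extension_def is_extension_def kernel_def)

lemma proj_incl [simp]: "a \<in> carrier H \<Longrightarrow> proj E (incl E a) = \<one>"
  using incl_image by blast

lemma proj_surj: "x \<in> carrier K \<Longrightarrow> \<exists>g\<in>carrier (mid E). proj E g = x"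
  using E unfolding is_lie_center_extension_def is_extension_def by (metis imageE)

text \<open>By exactness \<open>g\<close> times the inverse of \<open>k\<close> comes from
  \<open>H\<close>. Both the cochains of a section and the coordinates \<open>(a, x)\<close> on the
  middle term arise this way.\<close>

lemma same_proj:
  assumes "g \<in> carrier (mid E)" "k \<in> carrier (mid E)" "proj E g = proj E k"
  shows "\<exists>a\<in>carrier H. g = incl E a \<otimes>\<^bsub>mid E\<^esub> k"
proof -
  have "g \<otimes>\<^bsub>mid E\<^esub> inv\<^bsub>mid E\<^esub> k \<in> incl E ` carrier H"
    using assms by (simp add: incl_image)
  then obtain a where "a \<in> carrier H" "incl E a = g \<otimes>\<^bsub>mid E\<^esub> inv\<^bsub>mid E\<^esub> k" by auto
  then show ?thesis using assms by (intro bexI[of _ a]) (simp_all add: G.m_assoc)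
qed

lemma section_exists: "\<exists>t. is_section K E t"
proof -
  obtain t where t: "\<And>x. x \<in> carrier K \<Longrightarrow> t x \<in> carrier (mid E) \<and> proj E (t x) = x"
    using proj_surj by metis
  \<comment> \<open>Resetting the value at the identity turns an arbitrary choice of preimages into
    a normalized section.\<close>
  have "is_section K E (t(\<one> := \<one>\<^bsub>mid E\<^esub>))"
    using t by (auto simp: is_section_def)
  then show ?thesis by blast
qed

text \<open>\<open>induces_action\<close> speaks about sections only, so an element is reached
  through a section having it as a value. Over the identity that value is prescribed, hence the
  exclusion.\<close>

lemma section_through:
  assumes g: "g \<in> carrier (mid E)" "proj E g \<noteq> \<one>"
  shows "\<exists>t. is_section K E t \<and> t (proj E g) = g"
proof -
  obtain t where "is_section K E t" using section_exists by blast
  then have "is_section K E (t(proj E g := g))"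
    using g by (auto simp: is_section_def)
  then show ?thesis by (intro exI[of _ "t(proj E g := g)"]) simp
qed

text \<open>Conjugates of \<open>incl E a\<close> lie in the kernel, so by exactness the
  \<open>inv_into\<close> in \<open>section_action\<close> is a genuine preimage, and the condition
  becomes an equation in \<open>mid E\<close>.\<close>

lemma section_action_eq_iff:
  assumes t: "is_section K E t" and x: "x \<in> carrier K"
  shows "section_action H E t x = \<sigma> x \<longleftrightarrow>
    (\<forall>a\<in>carrier H. t x \<otimes>\<^bsub>mid E\<^esub> incl E a = incl E (\<sigma> x a) \<otimes>\<^bsub>mid E\<^esub> t x)"
proof -
  have tx [simp]: "t x \<in> carrier (mid E)" using t x by (auto simp: is_section_def)
  have "section_action H E t x = \<sigma> x \<longleftrightarrow> (\<forall>a\<in>carrier H. section_action H E t x a = \<sigma> x a)"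
  proof
    assume "\<forall>a\<in>carrier H. section_action H E t x a = \<sigma> x a"
    then show "section_action H E t x = \<sigma> x"
      using \<sigma>_extensional[OF x]
      by (intro extensionalityI[of _ "carrier H"]) (simp_all add: section_action_def)
  qed simp
  also have "\<dots> \<longleftrightarrow>
    (\<forall>a\<in>carrier H. t x \<otimes>\<^bsub>mid E\<^esub> incl E a = incl E (\<sigma> x a) \<otimes>\<^bsub>mid E\<^esub> t x)"
  proof (rule ball_cong[OF refl])
    fix a assume a: "a \<in> carrier H"
    have "t x \<rhd>\<^bsub>mid E\<^esub> incl E a \<in> incl E ` carrier H"
      using a x by (simp add: incl_image conj_by_def)
    then obtain b where b: "b \<in> carrier H" "incl E b = t x \<rhd>\<^bsub>mid E\<^esub> incl E a" by auto
    have "section_action H E t x a = b"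
      using a b E by (simp add: section_action_def flip: b(2))
        (simp add: is_lie_center_extension_def is_extension_def)
    moreover have "t x \<otimes>\<^bsub>mid E\<^esub> incl E a = incl E b \<otimes>\<^bsub>mid E\<^esub> t x"
      using a b by (simp add: conj_by_def G.m_assoc)
    ultimately show "section_action H E t x a = \<sigma> x a \<longleftrightarrow>
        t x \<otimes>\<^bsub>mid E\<^esub> incl E a = incl E (\<sigma> x a) \<otimes>\<^bsub>mid E\<^esub> t x"
      using a b(1) x by (simp add: incl_eq_iff)
  qed
  finally show ?thesis .
qed

text \<open>Off the kernel, a section through \<open>g\<close> gives the equation; on the kernel
  \<open>g\<close> comes from \<open>H\<close>, where commutativity and the triviality of
  \<open>\<sigma> \<one>\<close> give it. Free of sections, this form carries over along
  isomorphisms directly.\<close>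

lemma induces_action_iff:
  "induces_action H K E \<sigma> \<longleftrightarrow> (\<forall>g\<in>carrier (mid E). \<forall>a\<in>carrier H.
    g \<otimes>\<^bsub>mid E\<^esub> incl E a = incl E (\<sigma> (proj E g) a) \<otimes>\<^bsub>mid E\<^esub> g)"
proof
  assume act: "induces_action H K E \<sigma>"
  show "\<forall>g\<in>carrier (mid E). \<forall>a\<in>carrier H.
    g \<otimes>\<^bsub>mid E\<^esub> incl E a = incl E (\<sigma> (proj E g) a) \<otimes>\<^bsub>mid E\<^esub> g"
  proof (intro ballI)
    fix g a assume g: "g \<in> carrier (mid E)" and a: "a \<in> carrier H"
    show "g \<otimes>\<^bsub>mid E\<^esub> incl E a = incl E (\<sigma> (proj E g) a) \<otimes>\<^bsub>mid E\<^esub> g"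
    proof (cases "proj E g = \<one>")
      case True
      then obtain b where "b \<in> carrier H" "g = incl E b"
        using incl_image g by blast
      then show ?thesis using a by (simp flip: i.hom_mult add: H.m_comm)
    next
      case False
      then obtain t where t: "is_section K E t" "t (proj E g) = g"
        using section_through g by blast
      then show ?thesis
        using act section_action_eq_iff[OF t(1), of "proj E g"] g a
        by (simp add: induces_action_def)
    qed
  qed
next
  assume "\<forall>g\<in>carrier (mid E). \<forall>a\<in>carrier H.
    g \<otimes>\<^bsub>mid E\<^esub> incl E a = incl E (\<sigma> (proj E g) a) \<otimes>\<^bsub>mid E\<^esub> g"
  then show "induces_action H K E \<sigma>"
    unfolding induces_action_def
    by (auto simp: section_action_eq_iff) (auto simp: is_section_def Pi_iff)
qed

text \<open>A section preserves the two operations up to elements of \<open>H\<close>; these defects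
  are \<open>f\<close> and \<open>h\<close>, and \<open>(a, x) \<mapsto> a t(x)\<close> is the
  equivalence.\<close>

lemma ext_equiv_cocycle_extension:
  assumes act: "induces_action H K E \<sigma>"
  shows "\<exists>f h. (f, h, \<sigma>) \<in> Z2_ML K H \<sigma> \<and> ext_equiv H K (cocycle_extension f h) E"
proof -
  obtain t where "is_section K E t" using section_exists by blast
  then have tc [simp]: "\<And>x. x \<in> carrier K \<Longrightarrow> t x \<in> carrier (mid E)"
    and pt [simp]: "\<And>x. x \<in> carrier K \<Longrightarrow> proj E (t x) = x"
    and t1 [simp]: "t \<one> = \<one>\<^bsub>mid E\<^esub>"
    by (auto simp: is_section_def)
  have comm: "t x \<otimes>\<^bsub>mid E\<^esub> incl E a = incl E (\<sigma> x a) \<otimes>\<^bsub>mid E\<^esub> t x"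
    if "x \<in> carrier K" "a \<in> carrier H" for x a
    using act that by (simp add: induces_action_iff)
  note [simp] = G.lie_closed proj_lie
  have "\<exists>a\<in>carrier H. t x \<otimes>\<^bsub>mid E\<^esub> t y = incl E a \<otimes>\<^bsub>mid E\<^esub> t (x \<otimes> y)"
    "\<exists>a\<in>carrier H. t x \<star>\<^bsub>mid E\<^esub> t y = incl E a \<otimes>\<^bsub>mid E\<^esub> t (x \<star> y)"
    if "x \<in> carrier K" "y \<in> carrier K" for x y
    using that by (auto intro!: same_proj)
  then obtain f0 h0 where
    f0: "\<And>x y. x \<in> carrier K \<Longrightarrow> y \<in> carrier K \<Longrightarrow> f0 x y \<in> carrier H \<and>
      t x \<otimes>\<^bsub>mid E\<^esub> t y = incl E (f0 x y) \<otimes>\<^bsub>mid E\<^esub> t (x \<otimes> y)" and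
    h0: "\<And>x y. x \<in> carrier K \<Longrightarrow> y \<in> carrier K \<Longrightarrow> h0 x y \<in> carrier H \<and>
      t x \<star>\<^bsub>mid E\<^esub> t y = incl E (h0 x y) \<otimes>\<^bsub>mid E\<^esub> t (x \<star> y)"
    by metis
  \<comment> \<open>Restriction makes the chosen functions extensional, as \<open>normalized\<close>
    demands.\<close>
  define f where "f = (\<lambda>(x, y) \<in> carrier K \<times> carrier K. f0 x y)"
  define h where "h = (\<lambda>(x, y) \<in> carrier K \<times> carrier K. h0 x y)"
  have fc [simp]: "f (x, y) \<in> carrier H" "h (x, y) \<in> carrier H"
    if "x \<in> carrier K" "y \<in> carrier K" for x y
    using f0 h0 that by (simp_all add: f_def h_def)
  have f_eq: "t x \<otimes>\<^bsub>mid E\<^esub> t y = incl E (f (x, y)) \<otimes>\<^bsub>mid E\<^esub> t (x \<otimes> y)"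
    and h_eq: "t x \<star>\<^bsub>mid E\<^esub> t y = incl E (h (x, y)) \<otimes>\<^bsub>mid E\<^esub> t (x \<star> y)"
    if "x \<in> carrier K" "y \<in> carrier K" for x y
    using f0 h0 that by (simp_all add: f_def h_def)
  have incl_one: "a = \<one>\<^bsub>H\<^esub>" if "a \<in> carrier H" "incl E a = \<one>\<^bsub>mid E\<^esub>" for a
    using that incl_eq_iff[of a "\<one>\<^bsub>H\<^esub>"] by simp
  have f: "normalized f"
  proof -
    \<comment> \<open>Normalization comes from \<open>t1\<close>: at the identity the section has no
      defect.\<close>
    have "f (\<one>, x) = \<one>\<^bsub>H\<^esub> \<and> f (x, \<one>) = \<one>\<^bsub>H\<^esub>" if "x \<in> carrier K" for x
      using f_eq[OF K.one_closed that, symmetric] f_eq[OF that K.one_closed, symmetric] that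
      by (auto intro!: incl_one)
    moreover have "f \<in> carrier K \<times> carrier K \<rightarrow>\<^sub>E carrier H" using f0 by (auto simp: f_def)
    ultimately show ?thesis by (simp only: normalized_def) blast
  qed
  have h: "normalized h"
  proof -
    have "h (\<one>, x) = \<one>\<^bsub>H\<^esub> \<and> h (x, \<one>) = \<one>\<^bsub>H\<^esub>" if "x \<in> carrier K" for x
      using h_eq[OF K.one_closed that, symmetric] h_eq[OF that K.one_closed, symmetric] that
      by (auto intro!: incl_one)
    moreover have "h \<in> carrier K \<times> carrier K \<rightarrow>\<^sub>E carrier H" using h0 by (auto simp: h_def)
    ultimately show ?thesis by (simp only: normalized_def) blast
  qed
  note [simp] = f h
  define \<phi> where "\<phi> = (\<lambda>(a, x). incl E a \<otimes>\<^bsub>mid E\<^esub> t x)"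
  have \<phi> [simp]: "\<phi> (a, x) = incl E a \<otimes>\<^bsub>mid E\<^esub> t x" for a x by (simp add: \<phi>_def)
  have bij: "bij_betw \<phi> (carrier (cocycle_algebra f h)) (carrier (mid E))"
    unfolding bij_betw_def
  proof
    show "inj_on \<phi> (carrier (cocycle_algebra f h))"
    proof (rule inj_onI)
      fix p q assume "p \<in> carrier (cocycle_algebra f h)" "q \<in> carrier (cocycle_algebra f h)"
        and eq: "\<phi> p = \<phi> q"
      then obtain a x b y where p: "p = (a, x)" "a \<in> carrier H" "x \<in> carrier K"
        and q: "q = (b, y)" "b \<in> carrier H" "y \<in> carrier K" by auto
      have "x = y" using arg_cong[OF eq, of "proj E"] p q by simp
      then show "p = q" using eq p q by (simp add: incl_eq_iff)
    qed
    show "\<phi> ` carrier (cocycle_algebra f h) = carrier (mid E)"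
    proof
      show "\<phi> ` carrier (cocycle_algebra f h) \<subseteq> carrier (mid E)" by auto
      show "carrier (mid E) \<subseteq> \<phi> ` carrier (cocycle_algebra f h)"
      proof
        fix g assume g: "g \<in> carrier (mid E)"
        then obtain a where "a \<in> carrier H" "g = incl E a \<otimes>\<^bsub>mid E\<^esub> t (proj E g)"
          using same_proj[of g "t (proj E g)"] by auto
        then show "g \<in> \<phi> ` carrier (cocycle_algebra f h)"
          using g by (intro image_eqI[of _ _ "(a, proj E g)"]) simp_all
      qed
    qed
  qed
  have mult: "\<phi> (p \<otimes>\<^bsub>cocycle_algebra f h\<^esub> q) = \<phi> p \<otimes>\<^bsub>mid E\<^esub> \<phi> q"
    and lie: "\<phi> (p \<star>\<^bsub>cocycle_algebra f h\<^esub> q) = \<phi> p \<star>\<^bsub>mid E\<^esub> \<phi> q"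
    if pq: "p \<in> carrier (cocycle_algebra f h)" "q \<in> carrier (cocycle_algebra f h)" for p q
  proof -
    obtain a x b y where p: "p = (a, x)" "a \<in> carrier H" "x \<in> carrier K"
      and q: "q = (b, y)" "b \<in> carrier H" "y \<in> carrier K" using pq by auto
    let ?ab = "a \<cdot> b"
    have "\<phi> p \<otimes>\<^bsub>mid E\<^esub> \<phi> q =
        incl E a \<otimes>\<^bsub>mid E\<^esub> ((t x \<otimes>\<^bsub>mid E\<^esub> incl E b) \<otimes>\<^bsub>mid E\<^esub> t y)"
      using p q by (simp add: G.m_assoc)
    also have "\<dots> = incl E a \<otimes>\<^bsub>mid E\<^esub> incl E (\<sigma> x b) \<otimes>\<^bsub>mid E\<^esub> (t x \<otimes>\<^bsub>mid E\<^esub> t y)"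
      using p q by (simp add: comm G.m_assoc)
    also have "\<dots> = \<phi> (p \<otimes>\<^bsub>cocycle_algebra f h\<^esub> q)"
      using p q by (simp add: f_eq G.m_assoc)
    finally show "\<phi> (p \<otimes>\<^bsub>cocycle_algebra f h\<^esub> q) = \<phi> p \<otimes>\<^bsub>mid E\<^esub> \<phi> q" ..
    \<comment> \<open>Lie centrality of \<open>H\<close> reduces the product to a conjugate of
      \<open>t x \<star> t y\<close>; moving the inverse of \<open>?ab\<close> to the left past
      \<open>t (x \<star> y)\<close> then produces the action of \<open>x \<star> y\<close>.\<close>
    have "\<phi> p \<star>\<^bsub>mid E\<^esub> \<phi> q = incl E ?ab \<rhd>\<^bsub>mid E\<^esub> (t x \<star>\<^bsub>mid E\<^esub> t y)"
      using p q by (simp add: G.lie_mult_lie_center incl_in_lie_center)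
    also have "\<dots> = incl E ?ab \<otimes>\<^bsub>mid E\<^esub> incl E (h (x, y)) \<otimes>\<^bsub>mid E\<^esub>
        (t (x \<star> y) \<otimes>\<^bsub>mid E\<^esub> incl E (?ab\<^sup>-))"
      using p q by (simp add: conj_by_def h_eq G.m_assoc)
    also have "\<dots> = incl E (?ab \<cdot> h (x, y) \<cdot> \<sigma> (x \<star> y) (?ab\<^sup>-)) \<otimes>\<^bsub>mid E\<^esub> t (x \<star> y)"
      using p q by (simp add: comm G.m_assoc del: i.hom_inv)
    also have "?ab \<cdot> h (x, y) \<cdot> \<sigma> (x \<star> y) (?ab\<^sup>-) = ?ab \<cdot> \<sigma> (x \<star> y) (a\<^sup>- \<cdot> b\<^sup>-) \<cdot> h (x, y)"
      using p q by (simp add: H.inv_mult H.m_ac)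
    finally show "\<phi> (p \<star>\<^bsub>cocycle_algebra f h\<^esub> q) = \<phi> p \<star>\<^bsub>mid E\<^esub> \<phi> q"
      using p q by simp
  qed
  have "mult_lie_algebra (cocycle_algebra f h)"
    by (rule mult_lie_algebra_pullback[OF G.mult_lie_algebra_axioms bij _ _ _ _ mult lie]) auto
  then have "(f, h, \<sigma>) \<in> Z2_ML K H \<sigma>" by (simp add: Z2_ML_iff)
  moreover have "\<phi> \<in> mlie_iso (cocycle_algebra f h) (mid E)"
    unfolding mlie_iso_def mlie_hom_def
    using bij mult lie bij_betwE[OF bij]
    by (auto intro!: homI simp del: cocycle_algebra_simps(2-4) \<phi>)
  then have "ext_equiv H K (cocycle_extension f h) E"
    unfolding ext_equiv_def by (intro bexI[of _ \<phi>]) auto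
  ultimately show ?thesis by blast
qed

end

section \<open>Extensions built from cocycles, and their transport\<close>

lemma cocycle_extension_lie_center_extension:
  assumes Z: "(f, h, \<sigma>) \<in> Z2_ML K H \<sigma>"
  shows "cocycle_extension f h \<in> lie_center_extensions H K \<sigma>"
proof -
  have f: "normalized f" and h: "normalized h" and "mult_lie_algebra (cocycle_algebra f h)"
    using Z by (simp_all add: Z2_ML_iff)
  then interpret M: mult_lie_algebra "cocycle_algebra f h" by simp
  note [simp] = f h
  have a: "\<And>a b. a \<in> carrier H \<Longrightarrow> b \<in> carrier H \<Longrightarrow> a \<star>\<^bsub>H\<^esub> b = \<one>\<^bsub>H\<^esub>"
    using trivial by (simp add: trivial_lie_def)
  \<comment> \<open>Lie products with \<open>(a, \<one>)\<close> lie over the identity of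
    \<open>K\<close>, where the action is trivial and \<open>h\<close> is one, so their
    \<open>H\<close>-component has this shape.\<close>
  have cancel: "a \<cdot> b \<cdot> (a\<^sup>- \<cdot> b\<^sup>-) = \<one>\<^bsub>H\<^esub>" if "a \<in> carrier H" "b \<in> carrier H" for a b
    using that by (simp add: H.m_ac)
  have "is_lie_center_extension H K (cocycle_extension f h)"
    unfolding is_lie_center_extension_def is_extension_def
  proof (intro conjI)
    show "incl (cocycle_extension f h) \<in> mlie_hom H (mid (cocycle_extension f h))"
      by (auto simp: mlie_hom_def a cancel intro!: homI)
    show "proj (cocycle_extension f h) \<in> mlie_hom (mid (cocycle_extension f h)) K"
      by (auto simp: mlie_hom_def intro!: homI)
    show "incl (cocycle_extension f h) ` carrier H =
        kernel (mid (cocycle_extension f h)) K (proj (cocycle_extension f h))"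
      by (auto simp: kernel_def)
    show "incl (cocycle_extension f h) ` carrier H \<subseteq> lie_center (mid (cocycle_extension f h))"
      by (auto simp: lie_center_def cancel)
  qed (auto simp: inj_on_def M.mult_lie_algebra_axioms)
  then show ?thesis
    by (auto simp: lie_center_extensions_def induces_action_iff H.m_comm)
qed

text \<open>The two middle terms may have different element types. The carrier, both maps, the
  kernel and the Lie center condition of \<open>E'\<close> are images under \<open>\<phi>\<close> of
  those of \<open>E\<close>, so every condition is rewritten into one on \<open>E\<close>.\<close>

lemma lie_center_extensions_ext_equiv:
  assumes E: "E \<in> lie_center_extensions H K \<sigma>" and E': "mult_lie_algebra (mid E')"
    and eq: "ext_equiv H K E E'"
  shows "E' \<in> lie_center_extensions H K \<sigma>"
proof -
  have EL: "is_lie_center_extension H K E" and act: "induces_action H K E \<sigma>"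
    using E by (simp_all add: lie_center_extensions_def)
  interpret G: mult_lie_algebra "mid E"
    using EL by (simp add: is_lie_center_extension_def is_extension_def)
  interpret G': mult_lie_algebra "mid E'" by fact
  obtain \<phi> where
    \<phi>: "\<phi> \<in> mlie_iso (mid E) (mid E')" and incl': "\<And>a. a\<in>carrier H \<Longrightarrow> incl E' a = \<phi> (incl E a)"
      and proj': "\<And>x. x\<in>carrier (mid E) \<Longrightarrow> proj E' (\<phi> x) = proj E x"
    using eq unfolding ext_equiv_def by metis
  from \<phi> have bij: "bij_betw \<phi> (carrier (mid E)) (carrier (mid E'))"
    and hom: "\<phi> \<in> hom (mid E) (mid E')"
    and lie: "\<And>x y. x \<in> carrier (mid E) \<Longrightarrow> y \<in> carrier (mid E) \<Longrightarrow>
      \<phi> x \<star>\<^bsub>mid E'\<^esub> \<phi> y = \<phi> (x \<star>\<^bsub>mid E\<^esub> y)"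
    unfolding mlie_iso_def mlie_hom_def by auto
  have mult: "\<And>x y. x \<in> carrier (mid E) \<Longrightarrow> y \<in> carrier (mid E) \<Longrightarrow>
      \<phi> x \<otimes>\<^bsub>mid E'\<^esub> \<phi> y = \<phi> (x \<otimes>\<^bsub>mid E\<^esub> y)"
    using hom by (simp add: hom_mult)
  have img: "carrier (mid E') = \<phi> ` carrier (mid E)" and inj: "inj_on \<phi> (carrier (mid E))"
    using bij by (auto simp: bij_betw_def)
  have one: "\<phi> \<one>\<^bsub>mid E\<^esub> = \<one>\<^bsub>mid E'\<^esub>"
    using hom_one[OF hom] G.is_group G'.is_group by blast
  from EL have
    incl: "incl E \<in> mlie_hom H (mid E)" and proj: "proj E \<in> mlie_hom (mid E) K"
    and inj_incl: "inj_on (incl E) (carrier H)"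
    and ker: "incl E ` carrier H = kernel (mid E) K (proj E)"
    and surj: "proj E ` carrier (mid E) = carrier K"
    and cen: "incl E ` carrier H \<subseteq> lie_center (mid E)"
    unfolding is_lie_center_extension_def is_extension_def by blast+
  have ic [simp]: "incl E a \<in> carrier (mid E)" if "a \<in> carrier H" for a
    using incl that by (auto simp: mlie_hom_def hom_def)
  have incl_hom: "incl E \<in> hom H (mid E)" using incl by (simp add: mlie_hom_def)
  have incl_lie: "incl E a \<star>\<^bsub>mid E\<^esub> incl E b = incl E (a \<star>\<^bsub>H\<^esub> b)"
    if "a \<in> carrier H" "b \<in> carrier H" for a b
    using incl that by (simp add: mlie_hom_def)
  have lie_H: "a \<star>\<^bsub>H\<^esub> b = \<one>\<^bsub>H\<^esub>" if "a \<in> carrier H" "b \<in> carrier H" for a b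
    using trivial that by (simp add: trivial_lie_def)
  have img_incl: "incl E' ` carrier H = \<phi> ` incl E ` carrier H"
    using incl' by (auto simp: image_image)
  have E'L: "is_lie_center_extension H K E'"
    unfolding is_lie_center_extension_def is_extension_def
  proof (intro conjI)
    show "mult_lie_algebra (mid E')" by fact
    show "incl E' \<in> mlie_hom H (mid E')"
      using hom_in_carrier[OF hom]
      by (auto simp: mlie_hom_def incl' mult lie hom_mult[OF incl_hom] incl_lie lie_H intro!: homI)
    show "proj E' \<in> mlie_hom (mid E') K"
      using proj
      by (auto simp: mlie_hom_def img proj' mult lie hom_mult G.lie_closed hom_in_carrier intro!: homI)
    show "inj_on (incl E') (carrier H)"
      using inj_incl inj by (auto simp: inj_on_def incl')
    show "incl E' ` carrier H = kernel (mid E') K (proj E')"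
      unfolding img_incl ker by (auto simp: kernel_def img proj')
    show "proj E' ` carrier (mid E') = carrier K"
      unfolding surj[symmetric] by (force simp: img proj')
    show "incl E' ` carrier H \<subseteq> lie_center (mid E')"
      unfolding img_incl using cen by (auto simp: lie_center_def img lie one)
  qed
  moreover have "induces_action H K E' \<sigma>"
    unfolding induces_action_iff[OF E'L] using act proj
    by (auto simp: induces_action_iff[OF EL] img incl' proj' mult mlie_hom_def hom_in_carrier)
  ultimately show ?thesis by (simp add: lie_center_extensions_def)
qed

text \<open>Cocycle extensions have elements of type \<open>'h \<times> 'k\<close>, whereas
  \<open>LExt\<close> is formed over a type \<open>'g\<close>. The structure is copied along
  \<open>j\<close>, which has to be injective on the carrier only; \<open>inv_into\<close> reads
  elements back.\<close>

definition transport_extension ::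
    "('m \<Rightarrow> 'g) \<Rightarrow> ('h, 'm, 'k) extension \<Rightarrow> ('h, 'g, 'k) extension" where
  "transport_extension j E = (let M = mid E; j' = inv_into (carrier M) j in
    \<lparr>mid = \<lparr>carrier = j ` carrier M, mult = (\<lambda>x y. j (j' x \<otimes>\<^bsub>M\<^esub> j' y)), one = j \<one>\<^bsub>M\<^esub>,
       lie = (\<lambda>x y. j (j' x \<star>\<^bsub>M\<^esub> j' y))\<rparr>,
     incl = j \<circ> incl E, proj = proj E \<circ> j'\<rparr>)"

lemma transport_extension:
  assumes E: "E \<in> lie_center_extensions H K \<sigma>" and j: "inj_on j (carrier (mid E))"
  shows "transport_extension j E \<in> lie_center_extensions H K \<sigma>"
    and "ext_equiv H K E (transport_extension j E)"
proof -
  let ?N = "mid (transport_extension j E)" and ?j' = "inv_into (carrier (mid E)) j"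
  have "mult_lie_algebra (mid E)"
    using E by (simp add: lie_center_extensions_def is_lie_center_extension_def is_extension_def)
  then interpret M: mult_lie_algebra "mid E" .
  note [simp] = M.lie_closed inv_into_f_f[OF j]
  have N: "carrier ?N = j ` carrier (mid E)" "\<one>\<^bsub>?N\<^esub> = j \<one>\<^bsub>mid E\<^esub>"
    "x \<otimes>\<^bsub>?N\<^esub> y = j (?j' x \<otimes>\<^bsub>mid E\<^esub> ?j' y)" "x \<star>\<^bsub>?N\<^esub> y = j (?j' x \<star>\<^bsub>mid E\<^esub> ?j' y)" for x y
    by (simp_all add: transport_extension_def Let_def)
  have "mult_lie_algebra ?N"
  \<comment> \<open>Axioms are pulled back along a map from the new algebra to the old one, hence
    along the inverse of \<open>j\<close>.\<close>
  proof (rule mult_lie_algebra_pullback[OF M.mult_lie_algebra_axioms, where \<phi> = ?j'])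
    show "bij_betw ?j' (carrier ?N) (carrier (mid E))"
      unfolding N by (rule bij_betw_inv_into) (simp add: bij_betw_def j)
  qed (auto simp: N)
  moreover have "j \<in> mlie_iso (mid E) ?N"
    using j by (auto simp: mlie_iso_def mlie_hom_def N bij_betw_def intro!: homI)
  then show eq: "ext_equiv H K E (transport_extension j E)"
    unfolding ext_equiv_def
    by (intro bexI[of _ j]) (auto simp: transport_extension_def Let_def)
  ultimately show "transport_extension j E \<in> lie_center_extensions H K \<sigma>"
    using lie_center_extensions_ext_equiv[OF E] by blast
qed

end

section \<open>The correspondence of classes\<close>

theorem theorem3p9:
  fixes H :: "'h mlie" and K :: "'k mlie" and \<sigma> :: "'k \<Rightarrow> 'h \<Rightarrow> 'h"
    and j :: "'h \<times> 'k \<Rightarrow> 'g"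
  assumes "comm_group H" and "mult_lie_algebra H" and "trivial_lie H"
    and "mult_lie_algebra K"
    and "\<sigma> \<in> hom K (AutoGroup H)"
    and "inj_on j (carrier H \<times> carrier K)"
  shows "\<exists>\<Phi>. bij_betw \<Phi> (LExt H K \<sigma> :: ('h, 'g, 'k) extension set set) (H2_ML K H \<sigma>)"
proof -
  interpret center_action K H \<sigma>
    using assms by (simp add: center_action_def center_action_axioms_def)
  let ?A = "lie_center_extensions H K \<sigma> :: ('h, 'g, 'k) extension set"
  define F where "F = (\<lambda>(f, h, _ :: 'k \<Rightarrow> 'h \<Rightarrow> 'h). transport_extension j (cocycle_extension f h))"
  \<comment> \<open>Needed at two element types: \<open>'g\<close> for the members of
    \<open>?A\<close> and \<open>'h \<times> 'k\<close> for the cocycle extensions.\<close>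
  have ext: "is_extension H K E" if "E \<in> lie_center_extensions H K \<sigma>" for E :: "('h, 'm, 'k) extension"
    using that by (simp add: lie_center_extensions_def is_lie_center_extension_def)
  have F: "F (f, h, \<sigma>) \<in> ?A" "ext_equiv H K (cocycle_extension f h) (F (f, h, \<sigma>))"
      "ext_equiv H K (F (f, h, \<sigma>)) (cocycle_extension f h)"
    if "(f, h, \<sigma>) \<in> Z2_ML K H \<sigma>" for f h
    using transport_extension[OF cocycle_extension_lie_center_extension[OF that], of j] assms(6)
      ext_equiv_sym[OF ext[OF cocycle_extension_lie_center_extension[OF that]]]
    by (simp_all add: F_def)
  have Z: "\<exists>f h. c = (f, h, \<sigma>)" if "c \<in> Z2_ML K H \<sigma>" for c
    using that by (auto simp: Z2_ML_def)
  show ?thesis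
    unfolding LExt_def H2_ML_def
  proof (rule quotient_bij_of_pullback[where F = F])
    show "equiv ?A {(E, E'). E \<in> ?A \<and> E' \<in> ?A \<and> ext_equiv H K E E'}"
      using ext by (intro equivI refl_onI symI transI)
        (auto intro: ext_equiv_refl ext_equiv_sym ext_equiv_trans)
    show "F c \<in> ?A" if "c \<in> Z2_ML K H \<sigma>" for c
      using Z[OF that] F that by blast
    fix c c' assume c: "c \<in> Z2_ML K H \<sigma>" "c' \<in> Z2_ML K H \<sigma>"
    then obtain f h f' h' where cc: "c = (f, h, \<sigma>)" "c' = (f', h', \<sigma>)" using Z by blast
    note c = c[unfolded cc]
    \<comment> \<open>The criterion for cocycle extensions starts at the primed one, while the
      cohomology relation lists \<open>c\<close> first; symmetry reconciles the two.\<close>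
    have "ext_equiv H K (F c) (F c') \<longleftrightarrow> ext_equiv H K (F c') (F c)"
      using F c ext ext_equiv_sym unfolding cc by blast
    \<comment> \<open>Transport is removed by composing with the equivalences between each
      \<open>F c\<close> and its cocycle extension, available in both directions.\<close>
    also have "\<dots> \<longleftrightarrow> ext_equiv H K (cocycle_extension f' h') (cocycle_extension f h)"
      using F[OF c(1)] F[OF c(2)] unfolding cc by (blast intro: ext_equiv_trans)
    also have "\<dots> \<longleftrightarrow> (\<exists>b\<in>B2_ML K H \<sigma>. c' = cochain_mult K H b c)"
      unfolding cc by (rule ext_equiv_cocycle_extension_iff[OF c])
    finally show "(c, c') \<in> {(c, c'). c \<in> Z2_ML K H \<sigma> \<and> c' \<in> Z2_ML K H \<sigma> \<and>
          (\<exists>b\<in>B2_ML K H \<sigma>. c' = cochain_mult K H b c)} \<longleftrightarrow>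
        (F c, F c') \<in> {(E, E'). E \<in> ?A \<and> E' \<in> ?A \<and> ext_equiv H K E E'}"
      using F c unfolding cc by blast
  next
    fix E assume E: "E \<in> ?A"
    then obtain f h where fh: "(f, h, \<sigma>) \<in> Z2_ML K H \<sigma>" "ext_equiv H K (cocycle_extension f h) E"
      using ext_equiv_cocycle_extension[of E] by (auto simp: lie_center_extensions_def)
    then have "ext_equiv H K (F (f, h, \<sigma>)) E"
      using F ext_equiv_trans by blast
    then show "\<exists>c\<in>Z2_ML K H \<sigma>. (F c, E) \<in> {(E, E'). E \<in> ?A \<and> E' \<in> ?A \<and> ext_equiv H K E E'}"
      using fh E F by blast
  qed auto
qed

end
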